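(* Let $d\ge1$, $s\in(0,1)$ and $\lambda,\Lambda>0$. There exists a constant $c>0$ depending only on $d,s,\lambda$ and $\Lambda$ such that the following holds. Let $\rho\ge0$, $a\ge0$, $R>\rho$, and let $u\in L^\infty(\mathbb R^d\times I_R)$ satisfy $u\ge0$ in $\mathbb R^d\times\overline{I}_R$ and $$\partial_tu-\mathcal M_\rho^-u\ge -R^{-2s}a\quad\text{in } Q_R$$ in the viscosity sense. Then $$\inf_{Q_{R/2}}u\ \ge\ c\int_{I_R\setminus I_{R/2}}\int_{\mathbb R^d}\frac{u(x,t)}{(R+|x|)^{d+2s}}\,dx\,dt-a .$$
   Context: Notation: $B_R(x)=\{y\in\mathbb R^d:|x-y|<R\}$, $B_R=B_R(0)$, $I_R=(-R^{2s},0]$, $\overline I_R=[-R^{2s},0]$, $Q_R=B_R\times I_R$. Kernels: with the convention that $\rho^{-d-2s}=\infty$ if $\rho=0$ (so $\min\{|y|^{-d-2s},\rho^{-d-2s}\}=|y|^{-d-2s}$), $\mathcal K_\rho$ is the set of all measurable $K:\mathbb R^d\to[0,\infty)$ such that (1) $K(y)\ge\lambda\min\{|y|^{-d-2s},\rho^{-d-2s}\}$ for all $y\ne0$; (2) $\int_{B_{2r}\setminus B_r}K(y)\,dy\le\Lambda r^{-2s}$ for all $r>0$; (3) if $s=1/2$, additionally $\int_{B_{2r}\setminus B_r}yK(y)\,dy=0$ for all $r>0$. Operators (acting in space): $\delta_yu(x)=u(x+y)-u(x)$ if $s<1/2$; $\delta_yu(x)=u(x+y)-u(x)-y\cdot\nabla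 u(x)\mathbf 1_{B_1}(y)$ if $s=1/2$; $\delta_yu(x)=u(x+y)-u(x)-y\cdot\nabla u(x)$ if $s>1/2$. $L_Ku(x)=\int_{\mathbb R^d}\delta_yu(x)K(y)\,dy$, $\mathcal M_\rho^-u(x)=\inf_{K\in\mathcal K_\rho}L_Ku(x)$. It is tacitly assumed that $\mathcal K_\rho\neq\emptyset$. Since functions are evaluated pointwise, $L^\infty(\mathbb R^d\times I)$ means bounded Borel measurable functions defined everywhere. Viscosity sense: let $\Omega\subseteq\mathbb R^d$ be a domain, $I\subseteq(-\infty,0]$ a left-open interval and $f:\Omega\times I\to\mathbb R$; $\partial_t$ is the left derivative in time. A function $u\in L^\infty(\mathbb R^d\times I)$ that is lower semicontinuous in $\Omega\times I$ satisfies $\partial_tu-\mathcal M_\rho^-u\ge f$ in $\Omega\times I$ in the viscosity sense if for every $(x_0,t_0)\in\Omega\times I$, every $\varepsilon>0$ with $B_\varepsilon(x_0)\times(t_0-\varepsilon,t_0]\subseteq\Omega\times I$ and every $\varphi:B_\varepsilon(x_0)\times(t_0-\varepsilon,t_0]\to\mathbb R$ that is left-differentiable in time and $C^{1,1}$ in space with $u(x_0,t_0)=\varphi(x_0,t_0)$ and $u\ge\varphi$ in $B_\varepsilon(x_0)\times(t_0-\varepsilon,t_0]$, the function $v$ equal to $\varphi$ in $B_\varepsilon(x_0)\times(t_0-\varepsilon,t_0]$ and to $u$ elsewhere in $\mathbb R^d\times I$ satisfies $\partial_tv(x_0,t_0)-\mathcal M_\rho^-v(x_0,t_0)\ge f(x_0,t_0)$.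 *)

theory Defs
  imports "HOL-Analysis.Analysis"
begin

text \<open>
  Space is an arbitrary Euclidean space \<open>'a\<close>, so that \<open>d = DIM('a) \<ge> 1\<close>.
  Functions on subsets of \<open>\<real>\<^sup>d\<close> or \<open>\<real>\<^sup>d \<times> \<real>\<close> are total functions of which only the values on
  the relevant set are ever constrained.
\<close>

subsection \<open>Intervals and cylinders\<close>

definition time_ivl :: "real \<Rightarrow> real \<Rightarrow> real set" where
  "time_ivl s R = {-(R powr (2 * s))<..0}"

definition closed_time_ivl :: "real \<Rightarrow> real \<Rightarrow> real set" where
  "closed_time_ivl s R = {-(R powr (2 * s))..0}"

definition cylinder :: "real \<Rightarrow> real \<Rightarrow> ('a::euclidean_space \<times> real) set" where
  "cylinder s R = ball 0 R \<times> time_ivl s R"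

definition Linf :: "('a::euclidean_space \<times> real) set \<Rightarrow> ('a \<times> real \<Rightarrow> real) set" where
  "Linf S = {u. u \<in> borel_measurable (restrict_space borel S) \<and> bounded (u ` S)}"

definition lsc_on :: "'b::topological_space set \<Rightarrow> ('b \<Rightarrow> real) \<Rightarrow> bool" where
  "lsc_on S u \<longleftrightarrow> (\<forall>p\<in>S. \<forall>y<u p. eventually (\<lambda>q. y < u q) (at p within S))"

subsection \<open>Kernels and operators\<close>

text \<open>The case \<open>\<rho> = 0\<close> implements the convention \<open>0\<^bsup>-d-2s\<^esup> = \<infinity>\<close> (in HOL, \<open>0 powr z = 0\<close>).\<close>

definition kernel_lower :: "real \<Rightarrow> real \<Rightarrow> 'a::euclidean_space \<Rightarrow> real" where
  "kernel_lower s \<rho> y =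
     (if \<rho> = 0 then norm y powr (- real DIM('a) - 2 * s)
      else min (norm y powr (- real DIM('a) - 2 * s)) (\<rho> powr (- real DIM('a) - 2 * s)))"

text \<open>The integral in the second condition is a nonnegative extended one, so the bound includes
  integrability of \<open>K\<close> on the annulus.\<close>

definition kernels :: "real \<Rightarrow> real \<Rightarrow> real \<Rightarrow> real \<Rightarrow> ('a::euclidean_space \<Rightarrow> real) set" where
  "kernels s lam Lam \<rho> =
     {K. K \<in> borel_measurable lebesgue \<and> (\<forall>y. 0 \<le> K y) \<and>
         (\<forall>y. y \<noteq> 0 \<longrightarrow> lam * kernel_lower s \<rho> y \<le> K y) \<and>
         (\<forall>r>0. (\<integral>\<^sup>+y\<in>ball 0 (2 * r) - ball 0 r. ennreal (K y) \<partial>lebesgue)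
                  \<le> ennreal (Lam * r powr (- 2 * s))) \<and>
         (s = 1 / 2 \<longrightarrow>
            (\<forall>r>0. (LINT y:ball 0 (2 * r) - ball 0 r|lebesgue. K y *\<^sub>R y) = 0))}"

definition gradient :: "('a::euclidean_space \<Rightarrow> real) \<Rightarrow> 'a \<Rightarrow> 'a" where
  "gradient w x = (THE D. GDERIV w x :> D)"

definition delta :: "real \<Rightarrow> 'a::euclidean_space \<Rightarrow> ('a \<Rightarrow> real) \<Rightarrow> 'a \<Rightarrow> real" where
  "delta s y w x =
     (if s < 1 / 2 then w (x + y) - w x
      else if s = 1 / 2 then w (x + y) - w x - (y \<bullet> gradient w x) * indicator (ball 0 1) y
      else w (x + y) - w x - y \<bullet> gradient w x)"

definition L_op :: "real \<Rightarrow> ('a::euclidean_space \<Rightarrow> real) \<Rightarrow> ('a \<Rightarrow> real) \<Rightarrow> 'a \<Rightarrow> real" where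
  "L_op s K w x = (LINT y|lebesgue. delta s y w x * K y)"

text \<open>If \<open>w\<close> is bounded, Borel measurable and \<open>C\<^sup>1\<^sup>,\<^sup>1\<close> near \<open>x\<close>, the integrals \<open>L_op s K w x\<close> converge
  absolutely and are bounded uniformly over the kernel class. So if that class is nonempty, the
  real infimum below is the genuine one.\<close>

definition M_minus ::
    "real \<Rightarrow> real \<Rightarrow> real \<Rightarrow> real \<Rightarrow> ('a::euclidean_space \<Rightarrow> real) \<Rightarrow> 'a \<Rightarrow> real" where
  "M_minus s lam Lam \<rho> w x = (INF K\<in>kernels s lam Lam \<rho>. L_op s K w x)"

subsection \<open>Viscosity supersolutions\<close>

definition left_deriv :: "(real \<Rightarrow> real) \<Rightarrow> real \<Rightarrow> real" where
  "left_deriv g t = (THE D. (g has_real_derivative D) (at_left t))"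

definition C11_on :: "'a::euclidean_space set \<Rightarrow> ('a \<Rightarrow> real) \<Rightarrow> bool" where
  "C11_on A w \<longleftrightarrow>
     (\<forall>x\<in>A. \<exists>D. GDERIV w x :> D) \<and> (\<exists>C. lipschitz_on C A (gradient w))"

text \<open>The Lipschitz constant of the spatial gradient of a test function may depend on time.\<close>

definition test_function :: "'a::euclidean_space set \<Rightarrow> real set \<Rightarrow> ('a \<times> real \<Rightarrow> real) \<Rightarrow> bool" where
  "test_function A J \<phi> \<longleftrightarrow>
     (\<forall>x\<in>A. \<forall>t\<in>J. \<exists>D. ((\<lambda>\<tau>. \<phi> (x, \<tau>)) has_real_derivative D) (at_left t)) \<and>
     (\<forall>t\<in>J. C11_on A (\<lambda>x. \<phi> (x, t)))"

text \<open>\<open>\<partial>\<^sub>t u - M\<^sub>\<rho>\<^sup>- u \<ge> f\<close> in \<open>\<Omega> \<times> I\<close>; meant for a domain \<open>\<Omega>\<close> and a left-open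
  interval \<open>I \<subseteq> (-\<infinity>, 0]\<close>.\<close>

definition viscosity_super ::
    "real \<Rightarrow> real \<Rightarrow> real \<Rightarrow> real \<Rightarrow> 'a::euclidean_space set \<Rightarrow> real set \<Rightarrow>
     ('a \<times> real \<Rightarrow> real) \<Rightarrow> ('a \<times> real \<Rightarrow> real) \<Rightarrow> bool" where
  "viscosity_super s lam Lam \<rho> \<Omega> I f u \<longleftrightarrow>
     u \<in> Linf (UNIV \<times> I) \<and> lsc_on (\<Omega> \<times> I) u \<and>
     (\<forall>x0\<in>\<Omega>. \<forall>t0\<in>I. \<forall>\<epsilon>>0. \<forall>\<phi>.
        ball x0 \<epsilon> \<times> {t0 - \<epsilon><..t0} \<subseteq> \<Omega> \<times> I \<longrightarrow>
        test_function (ball x0 \<epsilon>) {t0 - \<epsilon><..t0} \<phi> \<longrightarrow>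
        u (x0, t0) = \<phi> (x0, t0) \<longrightarrow>
        (\<forall>p \<in> ball x0 \<epsilon> \<times> {t0 - \<epsilon><..t0}. \<phi> p \<le> u p) \<longrightarrow>
        (let v = (\<lambda>p. if p \<in> ball x0 \<epsilon> \<times> {t0 - \<epsilon><..t0} then \<phi> p else u p)
         in left_deriv (\<lambda>t. v (x0, t)) t0 - M_minus s lam Lam \<rho> (\<lambda>x. v (x, t0)) x0
              \<ge> f (x0, t0)))"

end

theory Submission
  imports Defs
begin

text \<open>
  Write \<open>T = R powr (2 s)\<close>, \<open>\<psi>(x) = (max 0 (1 - |x|\<^sup>2/R\<^sup>2))\<^sup>2\<close>, \<open>w(x) = (2 (R + |x|)) powr (- d - 2 s)\<close>, and let
  \<open>g(t)\<close> be the integral of \<open>w u(\<cdot>,t)\<close>; up to a constant factor, \<open>g\<close> is the inner integral of the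
  theorem. The estimate comes from comparing \<open>u\<close> with the barrier
  \<open>\<psi>(x) exp(- C (t + T)/T) (lam/4) H(t) - a (t + T)/T\<close>, in which \<open>H\<close> is nearly the primitive of \<open>g\<close>
  restricted to \<open>time_ivl s R - time_ivl s (R/2)\<close>. On the smaller cylinder \<open>\<psi> \<ge> 9/16\<close>, the exponential
  is at least \<open>exp(- C)\<close>, \<open>H\<close> has collected almost the whole integral, and the last term is at most \<open>a\<close>.

  The barrier lies below \<open>u\<close> because of a gain of the nonlocal operator. At a point \<open>(x\<^sub>0,t\<^sub>0)\<close> where
  the barrier, lowered by a constant, touches \<open>u\<close> from below, the difference of \<open>u\<close> and the lowered
  barrier is nonnegative everywhere, and it is integrated against a kernel
  \<open>K(y) \<ge> lam w(x\<^sub>0 + y)\<close>. This produces the term \<open>(lam/4) g(t\<^sub>0)\<close>, which pays for the growth of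
  \<open>H\<close>. What is lost by applying the operator to \<open>\<psi>\<close> must be paid for by the decay of the
  exponential, which is multiplied by \<open>\<psi>(x\<^sub>0)\<close> and hence is weak near the boundary of the ball. The
  decisive point is therefore that the loss is at most \<open>C \<psi>(x\<^sub>0)/T\<close>. With
  \<open>p = 1 - |x\<^sub>0|\<^sup>2/R\<^sup>2\<close>, so that \<open>\<psi>(x\<^sub>0) = p\<^sup>2\<close>, convexity of \<open>z \<mapsto> (max 0 z)\<^sup>2\<close> bounds the negative
  part of the increments of \<open>\<psi>\<close> by a multiple of \<open>p\<close> times a function with finite moment
  (\<open>bump_increment\<close>, \<open>kernel_profile_bound\<close>). This is only linear in \<open>p\<close>, but part of the nonlocal gain
  is a fixed positive number \<open>c\<close>, a multiple of the integral of \<open>w \<psi>\<close>, and \<open>A p \<le> c + A\<^sup>2 p\<^sup>2/(4 c)\<close>. The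
  result is \<open>L_op_touching_lower_bound\<close>.

  Since \<open>g\<close> is merely measurable, its primitive need not be left differentiable. A test function only
  has to touch from below, so an upper bound on the left difference quotients of \<open>H\<close> suffices: near
  \<open>t\<^sub>0\<close> one replaces \<open>H\<close> by an affine function. Approximating \<open>g\<close> from below by combinations of
  indicators of closed sets gives an \<open>H\<close> with left slope at most \<open>g(t\<^sub>0)\<close> at every \<open>t\<^sub>0\<close>
  (\<open>ex_minor_function\<close>). The touching point is a global minimum of \<open>u\<close> minus the barrier, which exists by
  lower semicontinuity (\<open>supersolution_above_barrier\<close>).
\<close>

section \<open>Semicontinuous minima and minor functions\<close>

lemma lsc_attains_min:
  fixes f :: "'b::metric_space \<Rightarrow> real"
  assumes C: "compact C" "C \<noteq> {}" and lsc: "lsc_on C f"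
  shows "\<exists>x\<in>C. \<forall>y\<in>C. f x \<le> f y"
proof (rule ccontr)
  assume "\<not> ?thesis"
  then have "\<forall>x\<in>C. \<exists>y\<in>C. f y < f x" by (meson not_le)
  then obtain y where y: "\<And>x. x \<in> C \<Longrightarrow> y x \<in> C \<and> f (y x) < f x" by metis
  have "\<exists>U. open U \<and> x \<in> U \<and> (\<forall>q\<in>U \<inter> C. f (y x) < f q)" if x: "x \<in> C" for x
  proof -
    have "eventually (\<lambda>q. f (y x) < f q) (at x within C)"
      using lsc x y unfolding lsc_on_def by blast
    then obtain U where "open U" "x \<in> U" "\<forall>q\<in>U. q \<noteq> x \<longrightarrow> q \<in> C \<longrightarrow> f (y x) < f q"
      unfolding eventually_at_topological by blast
    then show ?thesis using y[OF x] by (metis IntE)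
  qed
  then obtain U where U: "\<And>x. x \<in> C \<Longrightarrow> open (U x) \<and> x \<in> U x \<and> (\<forall>q\<in>U x \<inter> C. f (y x) < f q)"
    by metis
  have "C \<subseteq> (\<Union>x\<in>C. U x)" using U by blast
  then obtain D where D: "D \<subseteq> C" "finite D" "C \<subseteq> (\<Union>x\<in>D. U x)"
    using compactE_image[OF C(1), of C U] U by metis
  then have "D \<noteq> {}" using C by auto
  then obtain x where x: "x \<in> D" "\<And>z. z \<in> D \<Longrightarrow> f (y x) \<le> f (y z)"
    using ex_min_if_finite[of "(\<lambda>x. f (y x)) ` D"] D(2) by (fastforce simp: not_less)
  obtain z where z: "z \<in> D" "y x \<in> U z" using D x y by blast
  then have "f (y z) < f (y x)" using U D x y by blast
  then show False using x(2)[OF z(1)] by simp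
qed

lemma lsc_on_diff_continuous:
  assumes "lsc_on S f" "continuous_on S h"
  shows "lsc_on S (\<lambda>p. f p - h p)"
  unfolding lsc_on_def
proof (intro ballI allI impI)
  fix p y assume p: "p \<in> S" and y: "y < f p - h p"
  define e where "e = (f p - h p - y) / 2"
  have e: "e > 0" using y by (simp add: e_def)
  have "eventually (\<lambda>q. f p - e < f q) (at p within S)"
    using assms(1) p e unfolding lsc_on_def by (metis diff_less_eq less_add_same_cancel1)
  moreover have "(h \<longlongrightarrow> h p) (at p within S)"
    using assms(2) p by (simp add: continuous_on_def)
  then have "eventually (\<lambda>q. h q < h p + e) (at p within S)"
    using e by (intro order_tendstoD(2)) auto
  ultimately show "eventually (\<lambda>q. y < f q - h q) (at p within S)"
    by eventually_elim (simp add: e_def field_simps)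
qed

lemma lsc_on_subset: "lsc_on S f \<Longrightarrow> S' \<subseteq> S \<Longrightarrow> lsc_on S' f"
  unfolding lsc_on_def by (meson at_le filter_leD subsetD)

lemma lmeasurable_Ioc [simp]: "{a<..b::real} \<in> lmeasurable"
  by (rule bounded_set_imp_lmeasurable) (auto intro: bounded_subset[of "{a..b}"])

text \<open>
  On the left of a point outside \<open>C\<close> the distribution function of \<open>C\<close> is locally constant, because
  \<open>C\<close> is closed; elsewhere its slope is at most one. For a set that is merely measurable the left
  slope would be controlled only almost everywhere.
\<close>
lemma closed_set_distribution_left_slope:
  fixes C :: "real set"
  assumes "closed C"
  shows "\<exists>\<epsilon>>0. \<forall>t\<in>{t0 - \<epsilon><..t0}.
           measure lebesgue (C \<inter> {t<..t0}) \<le> indicator C t0 * (t0 - t)"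
proof (cases "t0 \<in> C")
  case True
  have "measure lebesgue (C \<inter> {t<..t0}) \<le> measure lebesgue {t<..t0}" if "t \<le> t0" for t
    using assms by (intro measure_mono_fmeasurable) (auto simp: borel_closed)
  then show ?thesis using True by (intro exI[of _ 1]) auto
next
  case False
  then obtain \<epsilon> where \<epsilon>: "\<epsilon> > 0" "ball t0 \<epsilon> \<subseteq> - C"
    using assms open_contains_ball[of "- C"] by auto
  have "C \<inter> {t<..t0} = {}" if "t \<in> {t0 - \<epsilon><..t0}" for t
    using \<epsilon>(2) that by (auto simp: subset_eq dist_real_def)
  then show ?thesis using False \<epsilon>(1) by (intro exI[of _ \<epsilon>]) auto
qed

text \<open>
  A minor function of \<open>g\<close> in the sense of Perron, with left slope bounded by \<open>g\<close> at every point. It is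
  the sum of the distribution functions of closed subsets \<open>C i\<close> of the level sets
  \<open>{g \<ge> i h}\<close>, scaled by \<open>h\<close>. At \<open>t0\<close> the slopes of the summands add up to at most \<open>h\<close> times
  the number of levels that \<open>g t0\<close> has reached.
\<close>
lemma ex_minor_function:
  fixes g :: "real \<Rightarrow> real"
  assumes "a \<le> b" and int: "integrable lebesgue g" and bd: "\<And>t. 0 \<le> g t \<and> g t \<le> G"
    and supp: "\<And>t. t \<notin> {a<..b} \<Longrightarrow> g t = 0" and "0 < e" "0 < G"
  obtains H where "mono H" "\<And>t. t \<le> a \<Longrightarrow> H t = 0"
    "\<And>t. b \<le> t \<Longrightarrow> (LINT t|lebesgue. g t) - e \<le> H t"
    "\<And>t t'. t \<le> t' \<Longrightarrow> H t' - H t \<le> G * (t' - t)"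
    "\<And>t0. \<exists>\<epsilon>>0. \<forall>t\<in>{t0 - \<epsilon><..t0}. H t0 - H t \<le> g t0 * (t0 - t)"
proof -
  \<comment> \<open>Rounding \<open>g\<close> down to one of \<open>N\<close> levels of distance \<open>h = G / N\<close> costs at most \<open>e / 2\<close> of the integral, and
    passing to closed subsets of the level sets costs another \<open>e / 2\<close>.\<close>
  obtain N :: nat where N: "2 * G * (b - a) / e < real N" "N > 0"
    by (metis gr0I less_trans reals_Archimedean2 of_nat_0_less_iff of_nat_less_0_iff not_less_iff_gr_or_eq
        assms(1) assms(5) assms(6) divide_nonneg_pos mult_nonneg_nonneg diff_ge_0_iff_ge zero_le_numeral less_imp_le leD)
  define h where "h = G / N"
  have h: "h > 0" using N assms by (simp add: h_def)
  have hN: "h * real N = G" using N by (simp add: h_def)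
  have hba: "h * (b - a) \<le> e / 2"
    using N assms(5) by (simp add: h_def field_simps)
  define E where "E i = {t. real i * h \<le> g t}" for i
  have gm: "g \<in> borel_measurable lebesgue" using int by simp
  have E: "E i \<in> sets lebesgue" for i
  proof -
    have "E i = {t \<in> space lebesgue. real i * h \<le> g t}" by (auto simp: E_def)
    also have "\<dots> \<in> sets lebesgue" using gm by measurable
    finally show ?thesis .
  qed
  have Esub: "E i \<subseteq> {a<..b}" if "i \<ge> 1" for i
  proof
    fix t assume "t \<in> E i"
    then have "g t > 0" using h that unfolding E_def
      by (smt (verit) mem_Collect_eq mult_pos_pos of_nat_0_less_iff less_le_trans zero_less_one)
    then show "t \<in> {a<..b}" using supp[of t] by (cases "t \<in> {a<..b}") auto
  qed
  have "\<exists>C. closed C \<and> C \<subseteq> E i \<and> E i - C \<in> lmeasurable \<and> emeasure lebesgue (E i - C)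
      < ennreal (e / (2 * G))" for i
    using sets_lebesgue_inner_closed[OF E[of i], of "e / (2 * G)"] assms
      by (metis divide_pos_pos mult_pos_pos zero_less_numeral)
  then obtain C where C: "\<And>i. closed (C i)" "\<And>i. C i \<subseteq> E i" "\<And>i. E i - C i \<in> lmeasurable"
      "\<And>i. emeasure lebesgue (E i - C i) < ennreal (e / (2 * G))" by metis
  have Csub: "C i \<subseteq> {a<..b}" if "i \<ge> 1" for i using C(2) Esub[OF that] by blast
  have Clm: "C i \<inter> S \<in> lmeasurable" if "i \<ge> 1" "S \<in> sets borel" for i S
  proof -
    have "C i \<inter> S \<subseteq> {a..b}" using Csub[OF that(1)] by fastforce
    moreover have "C i \<inter> S \<in> sets lebesgue" using C(1)[of i] that by (auto simp: borel_closed)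
    ultimately show ?thesis using bounded_set_imp_lmeasurable bounded_subset bounded_closed_interval
      by metis
  qed
  define H where "H t = (\<Sum>i\<in>{1..N}. h * measure lebesgue (C i \<inter> {..t}))" for t
  have Hdiff: "H t' - H t = (\<Sum>i\<in>{1..N}. h * measure lebesgue (C i \<inter> {t<..t'}))" if "t \<le> t'" for t t'
  proof -
    have "measure lebesgue (C i \<inter> {..t'}) - measure lebesgue (C i \<inter> {..t})
        = measure lebesgue (C i \<inter> {t<..t'})"
      if i: "i \<in> {1..N}" for i
    proof -
      have "C i \<inter> {..t'} = (C i \<inter> {..t}) \<union> (C i \<inter> {t<..t'})" using \<open>t \<le> t'\<close> by auto
      moreover have "measure lebesgue ((C i \<inter> {..t}) \<union> (C i \<inter> {t<..t'})) =
          measure lebesgue (C i \<inter> {..t}) + measure lebesgue (C i \<inter> {t<..t'})"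
        using Clm i by (intro measure_Un_AE) auto
      ultimately show ?thesis by simp
    qed
    then show ?thesis unfolding H_def sum_subtractf[symmetric] right_diff_distrib[symmetric]
      by (intro sum.cong) auto
  qed
  show ?thesis
  proof (rule that[of H])
    show "mono H"
    proof (rule monoI)
      fix t t' :: real assume "t \<le> t'"
      have "0 \<le> H t' - H t" unfolding Hdiff[OF \<open>t \<le> t'\<close>] using h by (intro sum_nonneg) auto
      then show "H t \<le> H t'" by simp
    qed
    show "H t = 0" if "t \<le> a" for t
    proof -
      have "C i \<inter> {..t} = {}" if "i \<in> {1..N}" for i using Csub[of i] that \<open>t \<le> a\<close> by fastforce
      then show ?thesis by (simp add: H_def)
    qed
    show "H t' - H t \<le> G * (t' - t)" if "t \<le> t'" for t t'
    proof -
      have "H t' - H t \<le> (\<Sum>i\<in>{1..N}. h * (t' - t))" unfolding Hdiff[OF that]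
      proof (intro sum_mono mult_left_mono)
        fix i assume i: "i \<in> {1..N}"
        have "measure lebesgue (C i \<inter> {t<..t'}) \<le> measure lebesgue {t<..t'}"
          using C(1)[of i] by (intro measure_mono_fmeasurable) (auto simp: borel_closed)
        then show "measure lebesgue (C i \<inter> {t<..t'}) \<le> t' - t" using that by simp
      qed (use h in auto)
      also have "\<dots> = G * (t' - t)" unfolding hN[symmetric] by (simp add: algebra_simps)
      finally show ?thesis .
    qed
    show "\<exists>\<epsilon>>0. \<forall>t\<in>{t0 - \<epsilon><..t0}. H t0 - H t \<le> g t0 * (t0 - t)" for t0
    proof -
      obtain \<epsilon> where \<epsilon>: "\<And>i. \<epsilon> i > 0" "\<And>i t. t \<in> {t0 - \<epsilon> i<..t0} \<Longrightarrow>
          measure lebesgue (C i \<inter> {t<..t0}) \<le> indicator (C i) t0 * (t0 - t)"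
        using closed_set_distribution_left_slope[OF C(1)] by metis
      define \<epsilon>0 where "\<epsilon>0 = Min (\<epsilon> ` {1..N})"
      have \<epsilon>0: "\<epsilon>0 > 0" "\<And>i. i \<in> {1..N} \<Longrightarrow> \<epsilon>0 \<le> \<epsilon> i" using \<epsilon>(1) N by (auto simp: \<epsilon>0_def)
      have le: "(\<Sum>i\<in>{1..N}. h * indicator (C i) t0) \<le> g t0"
      proof -
        define k where "k = nat \<lfloor>g t0 / h\<rfloor>"
        have k: "real k * h \<le> g t0" using bd[of t0] h unfolding k_def
          by (simp add: pos_le_divide_eq[symmetric])
        have "i \<le> k" if "t0 \<in> C i" for i
        proof -
          have "real i \<le> g t0 / h" using C(2)[of i] that h by (auto simp: E_def pos_le_divide_eq)
          then show ?thesis unfolding k_def using le_nat_floor by blast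
        qed
        then have "indicator (C i) t0 \<le> (indicator {1..k} i :: real)" if "i \<in> {1..N}" for i
          using that by (auto simp: indicator_def)
        then have "(\<Sum>i\<in>{1..N}. h * indicator (C i) t0) \<le> (\<Sum>i\<in>{1..N}. h * indicator {1..k} i)"
          using h by (intro sum_mono mult_left_mono) auto
        also have "\<dots> = h * real (card ({1..N} \<inter> {1..k}))"
        proof -
          have "(\<Sum>i\<in>I. indicat_real J i) = real (card (I \<inter> J))" if "finite I" for I J :: "nat set"
            using that by (simp add: indicator_def sum.If_cases)
          from this[of "{1..N}" "{1..k}"] show ?thesis
            unfolding sum_distrib_left[symmetric] by simp
        qed
        also have "\<dots> \<le> h * real k" using h card_mono[of "{1..k}" "{1..N} \<inter> {1..k}"] by auto
        finally show ?thesis using k by (simp add: mult.commute)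
      qed
      have "H t0 - H t \<le> g t0 * (t0 - t)" if t: "t \<in> {t0 - \<epsilon>0<..t0}" for t
      proof -
        have "H t0 - H t \<le> (\<Sum>i\<in>{1..N}. h * (indicator (C i) t0 * (t0 - t)))"
          using t \<epsilon>0(2) h Hdiff[of t t0] by (auto intro!: sum_mono mult_left_mono \<epsilon>(2)) fastforce
        also have "\<dots> = (\<Sum>i\<in>{1..N}. h * indicator (C i) t0) * (t0 - t)"
          by (simp only: sum_distrib_right mult.assoc)
        also have "\<dots> \<le> g t0 * (t0 - t)" using le t by (intro mult_right_mono) auto
        finally show ?thesis .
      qed
      then show ?thesis using \<epsilon>0 by blast
    qed
    show "(LINT t|lebesgue. g t) - e \<le> H t" if t: "b \<le> t" for t
    proof -
      have Elm: "E i \<in> lmeasurable" if "i \<ge> 1" for i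
        by (rule bounded_set_imp_lmeasurable[OF bounded_subset[OF _ Esub[OF that]] E])
           (auto intro: bounded_subset[of "{a..b}"])
      have pt: "g \<tau> \<le> (\<Sum>i\<in>{1..N}. h * indicator (E i) \<tau>) + h * indicator {a<..b} \<tau>" for \<tau>
      proof (cases "\<tau> \<in> {a<..b}")
        case False
        then show ?thesis using supp[OF False] h by (auto intro!: add_nonneg_nonneg sum_nonneg)
      next
        case True
        define k where "k = nat \<lfloor>g \<tau> / h\<rfloor>"
        have gh: "0 \<le> g \<tau> / h" using bd[of \<tau>] h by simp
        have k1: "g \<tau> / h \<le> real k + 1" "real k \<le> g \<tau> / h" using gh unfolding k_def by linarith+
        have "g \<tau> / h \<le> real N" using bd[of \<tau>] h hN by (simp add: pos_divide_le_eq mult.commute)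
        then have kN: "k \<le> N" using k1 by linarith
        have "h * real k = h * real (card {1..k})" by simp
        also have "\<dots> = (\<Sum>i\<in>{1..k}. h * 1)" by simp
        also have "\<dots> \<le> (\<Sum>i\<in>{1..k}. h * indicator (E i) \<tau>)"
        proof (rule sum_mono)
          fix i assume "i \<in> {1..k}"
          then have "real i \<le> g \<tau> / h" using k1(2) by simp
          then have "\<tau> \<in> E i" using h by (simp add: E_def pos_le_divide_eq)
          then show "h * 1 \<le> h * indicator (E i) \<tau>" by simp
        qed
        also have "\<dots> \<le> (\<Sum>i\<in>{1..N}. h * indicator (E i) \<tau>)"
          using kN h by (intro sum_mono2) auto
        finally have "h * real k \<le> (\<Sum>i\<in>{1..N}. h * indicator (E i) \<tau>)" .
        moreover have "g \<tau> \<le> h * real k + h" using k1(1) h by (simp add: pos_divide_le_eq algebra_simps)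
        ultimately show ?thesis using True by simp
      qed
      have Eint: "integrable lebesgue (\<lambda>\<tau>. h * indicator (E i) \<tau>)" if "i \<in> {1..N}" for i
        using Elm[of i] that
          by (intro integrable_mult_right integrable_real_indicator) (auto simp: fmeasurable_def)
      have Iint: "integrable lebesgue (\<lambda>\<tau>. h * indicator {a<..b} \<tau>)"
        using assms by (intro integrable_mult_right integrable_real_indicator) auto
      have "(LINT t|lebesgue. g t) \<le>
          (LINT \<tau>|lebesgue. (\<Sum>i\<in>{1..N}. h * indicator (E i) \<tau>) + h * indicator {a<..b} \<tau>)"
        using int Eint Iint pt
          by (intro integral_mono Bochner_Integration.integrable_add Bochner_Integration.integrable_sum) auto
      also have "\<dots> = (LINT \<tau>|lebesgue. (\<Sum>i\<in>{1..N}. h * indicator (E i) \<tau>))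
          + (LINT \<tau>|lebesgue. h * indicator {a<..b} \<tau>)"
        by (rule Bochner_Integration.integral_add[OF Bochner_Integration.integrable_sum[OF Eint] Iint])
      also have "(LINT \<tau>|lebesgue. (\<Sum>i\<in>{1..N}. h * indicator (E i) \<tau>))
          = (\<Sum>i\<in>{1..N}. LINT \<tau>|lebesgue. h * indicator (E i) \<tau>)"
        by (rule Bochner_Integration.integral_sum[OF Eint])
      also have "\<dots> = (\<Sum>i\<in>{1..N}. h * measure lebesgue (E i))" by simp
      also have "(LINT \<tau>|lebesgue. h * indicator {a<..b} \<tau>) = h * (b - a)" using assms by simp
      also have "(\<Sum>i\<in>{1..N}. h * measure lebesgue (E i))
          \<le> (\<Sum>i\<in>{1..N}. h * (measure lebesgue (C i) + e / (2 * G)))"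
      proof (intro sum_mono mult_left_mono)
        fix i assume i: "i \<in> {1..N}"
        have "emeasure lebesgue (E i - C i) = ennreal (measure lebesgue (E i - C i))"
          using C(3)[of i] by (simp add: emeasure_eq_measure2)
        then have "measure lebesgue (E i - C i) < e / (2 * G)" using C(4)[of i] assms
          by (simp add: ennreal_less_iff)
        moreover have "measure lebesgue (E i - C i) = measure lebesgue (E i) - measure lebesgue (C i)"
          using Elm[of i] Clm[of i UNIV] C(2)[of i] i
          by (intro measurable_measure_Diff) auto
        ultimately show "measure lebesgue (E i) \<le> measure lebesgue (C i) + e / (2 * G)" by simp
      qed (use h in auto)
      also have "\<dots> = (\<Sum>i\<in>{1..N}. h * measure lebesgue (C i)) + real N * (h * (e / (2 * G)))"
        by (simp add: distrib_left sum.distrib)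
      also have "real N * (h * (e / (2 * G))) = e / 2" using hN assms by (simp add: field_simps)
      also have "(\<Sum>i\<in>{1..N}. h * measure lebesgue (C i)) = H t"
      proof -
        have "C i \<inter> {..t} = C i" if "i \<in> {1..N}" for i using Csub[of i] that t by fastforce
        then show ?thesis by (simp add: H_def)
      qed
      finally show ?thesis using hba by simp
    qed
  qed
qed

section \<open>Moments of the kernels\<close>

text \<open>
  The size of the increments of a bounded \<open>C\<^sup>1\<^sup>,\<^sup>1\<close> function that the operator of order \<open>2s\<close> sees,
  as a function of the relative jump length \<open>Y = |y|/R\<close>.
\<close>
definition profile :: "real \<Rightarrow> real \<Rightarrow> real" where
  "profile s Y = (if Y < 1 then Y powr (if s < 1/2 then 1 else 2)
                  else Y powr (if s \<le> 1/2 then 0 else 1))"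

lemma profile_nonneg: "0 \<le> profile s Y"
  by (simp add: profile_def)

lemma profile_ge_1: "1 \<le> Y \<Longrightarrow> 1 \<le> profile s Y"
  by (simp add: profile_def)

lemma profile_measurable [measurable]: "profile s \<in> borel_measurable borel"
  unfolding profile_def by measurable

lemma dyadic_block_above:
  fixes Y :: real assumes "1 \<le> Y"
  shows "\<exists>k. 2 ^ k \<le> Y \<and> Y < 2 ^ Suc k"
proof -
  obtain n where n: "Y < 2 ^ n" using real_arch_pow[of 2 Y] by auto
  define m where "m = (LEAST n. Y < 2 ^ n)"
  have m: "Y < 2 ^ m" unfolding m_def using n by (rule LeastI)
  then have "m \<noteq> 0" using assms by (auto intro: ccontr)
  then obtain k where k: "m = Suc k" by (cases m) auto
  have "\<not> Y < 2 ^ k" using not_less_Least[of k "\<lambda>n. Y < 2 ^ n"] k m_def by auto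
  then show ?thesis using m k by (auto intro!: exI[of _ k])
qed

lemma dyadic_block_below:
  fixes Y :: real assumes "0 < Y" "Y < 1"
  shows "\<exists>k. 1 / 2 ^ Suc k \<le> Y \<and> Y < 1 / 2 ^ k"
proof -
  obtain n where "(1/2) ^ n < Y" using real_arch_pow_inv[of Y "1/2"] assms by auto
  then have n: "1 / 2 ^ n \<le> Y" by (simp add: power_divide)
  define m where "m = (LEAST n. 1 / 2 ^ n \<le> Y)"
  have m: "1 / 2 ^ m \<le> Y" unfolding m_def using n by (rule LeastI)
  then have "m \<noteq> 0" using assms by (auto intro: ccontr)
  then obtain k where k: "m = Suc k" by (cases m) auto
  have "\<not> 1 / 2 ^ k \<le> Y" using not_less_Least[of k "\<lambda>n. 1 / 2 ^ n \<le> Y"] k m_def by auto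
  then show ?thesis using m k by (auto intro!: exI[of _ k])
qed

lemma kernels_measurable: "K \<in> kernels s lam Lam \<rho> \<Longrightarrow> K \<in> borel_measurable lebesgue"
  by (simp add: kernels_def)

lemma kernels_nonneg: "K \<in> kernels s lam Lam \<rho> \<Longrightarrow> 0 \<le> K y"
  by (simp add: kernels_def)

lemma kernels_annulus:
  "K \<in> kernels s lam Lam \<rho> \<Longrightarrow> r > 0 \<Longrightarrow>
    (\<integral>\<^sup>+y. ennreal (K y) * indicator (ball 0 (2 * r) - ball 0 r) y \<partial>lebesgue) \<le> ennreal (Lam * r powr (- 2 * s))"
  by (simp add: kernels_def)

text \<open>
  The kernel class controls masses of dyadic annuli only, so every moment estimate is a
  sum over annuli, on each of which the factor in front of the kernel is replaced by a constant.
\<close>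
lemma kernel_annuli_sum:
  fixes K :: "'a::euclidean_space \<Rightarrow> real" and r c :: "nat \<Rightarrow> real"
  assumes K: "K \<in> kernels s lam Lam \<rho>" and r: "\<And>k. 0 < r k" and c: "\<And>k. 0 \<le> c k" and Lam: "0 < Lam"
    and S: "(\<lambda>k. c k * r k powr (- 2 * s)) sums S"
    and cover: "\<And>y. y \<in> D \<Longrightarrow> \<exists>k. r k \<le> norm y \<and> norm y < 2 * r k \<and> f y \<le> c k"
  shows "(\<integral>\<^sup>+y. ennreal (f y * K y) * indicator D y \<partial>lebesgue) \<le> ennreal (Lam * S)"
proof -
  let ?A = "\<lambda>k. ball (0::'a) (2 * r k) - ball 0 (r k)"
  have ind: "(indicator (?A k) :: 'a \<Rightarrow> ennreal) \<in> borel_measurable lebesgue" for k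
    by (intro borel_measurable_indicator) auto
  have meas: "(\<lambda>y. ennreal (c k) * (ennreal (K y) * indicator (?A k) y)) \<in> borel_measurable lebesgue" for k
    using kernels_measurable[OF K] ind by measurable
  have "(\<integral>\<^sup>+y. ennreal (f y * K y) * indicator D y \<partial>lebesgue)
      \<le> (\<integral>\<^sup>+y. (\<Sum>k. ennreal (c k) * (ennreal (K y) * indicator (?A k) y)) \<partial>lebesgue)"
  proof (rule nn_integral_mono)
    fix y :: 'a
    show "ennreal (f y * K y) * indicator D y
        \<le> (\<Sum>k. ennreal (c k) * (ennreal (K y) * indicator (?A k) y))"
    proof (cases "y \<in> D")
      case True
      then obtain k where k: "r k \<le> norm y" "norm y < 2 * r k" "f y \<le> c k" using cover by blast
      have "ennreal (f y * K y) * indicator D y = ennreal (f y * K y)" using True by simp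
      also have "\<dots> \<le> ennreal (c k * K y)"
        by (intro ennreal_leI mult_right_mono k kernels_nonneg[OF K])
      also have "\<dots> = ennreal (c k) * (ennreal (K y) * indicator (?A k) y)"
        using k c by (simp add: ennreal_mult kernels_nonneg[OF K])
      also have "\<dots> \<le> (\<Sum>k. ennreal (c k) * (ennreal (K y) * indicator (?A k) y))"
        using sum_le_suminf[of "\<lambda>k. ennreal (c k) * (ennreal (K y) * indicator (?A k) y)" "{k}"] by simp
      finally show ?thesis .
    qed simp
  qed
  also have "\<dots> = (\<Sum>k. \<integral>\<^sup>+y. ennreal (c k) * (ennreal (K y) * indicator (?A k) y) \<partial>lebesgue)"
    by (rule nn_integral_suminf[OF meas])
  also have "\<dots> \<le> (\<Sum>k. ennreal (Lam * (c k * r k powr (- 2 * s))))"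
  proof (rule suminf_le)
    fix k
    have "(\<integral>\<^sup>+y. ennreal (c k) * (ennreal (K y) * indicator (?A k) y) \<partial>lebesgue)
        = ennreal (c k) * (\<integral>\<^sup>+y. ennreal (K y) * indicator (?A k) y \<partial>lebesgue)"
      using kernels_measurable[OF K] ind by (intro nn_integral_cmult) measurable
    also have "\<dots> \<le> ennreal (c k) * ennreal (Lam * r k powr (- 2 * s))"
      by (intro mult_left_mono kernels_annulus[OF K r]) auto
    also have "\<dots> = ennreal (Lam * (c k * r k powr (- 2 * s)))"
      using c Lam by (simp add: ennreal_mult[symmetric] mult_ac)
    finally show "(\<integral>\<^sup>+y. ennreal (c k) * (ennreal (K y) * indicator (?A k) y) \<partial>lebesgue)
        \<le> ennreal (Lam * (c k * r k powr (- 2 * s)))" .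
  qed auto
  also have "\<dots> = ennreal (Lam * S)"
    using c Lam by (intro suminf_ennreal_eq sums_mult S) auto
  finally show ?thesis .
qed

lemma sums_geometric_powr:
  fixes e :: real assumes "e < 0"
  shows "(\<lambda>k. M * (2 powr e) ^ k) sums (M * (1 / (1 - 2 powr e)))"
proof -
  have "2 powr e < (1::real)" using powr_less_mono[OF assms, of 2] by simp
  then show ?thesis by (intro sums_mult geometric_sums) auto
qed

text \<open>
  Near the origin the exponent exceeds \<open>2s\<close> and far away it is below \<open>2s\<close>, so the sums over annuli
  are geometric in both directions.
\<close>
lemma kernel_profile_bound:
  fixes s lam Lam :: real
  assumes s: "0 < s" "s < 1" and Lam: "0 < Lam"
  shows "\<exists>C>0. \<forall>\<rho> R. \<forall>K :: 'a::euclidean_space \<Rightarrow> real.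
        0 < R \<longrightarrow> K \<in> kernels s lam Lam \<rho> \<longrightarrow>
        integrable lebesgue (\<lambda>y. profile s (norm y / R) * K y) \<and>
        (LINT y|lebesgue. profile s (norm y / R) * K y) \<le> C * R powr (- 2 * s)"
proof -
  define \<alpha> :: real where "\<alpha> = (if s < 1/2 then 1 else 2)"
  define \<beta> :: real where "\<beta> = (if s \<le> 1/2 then 0 else 1)"
  have \<alpha>: "2 * s - \<alpha> < 0" "\<alpha> > 0" and \<beta>: "\<beta> - 2 * s < 0" "\<beta> \<ge> 0" using s by (auto simp: \<alpha>_def \<beta>_def)
  define N where "N = 2 powr (2 * s) * (1 / (1 - 2 powr (2 * s - \<alpha>)))"
  define F where "F = 2 powr \<beta> * (1 / (1 - 2 powr (\<beta> - 2 * s)))"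
  have "2 powr (2 * s - \<alpha>) < (1::real)" "2 powr (\<beta> - 2 * s) < (1::real)"
    using powr_less_mono[OF \<alpha>(1), of 2] powr_less_mono[OF \<beta>(1), of 2] by auto
  then have pos: "N > 0" "F > 0" by (auto simp: N_def F_def)
  have "0 < Lam * (N + F)" using pos Lam by simp
  moreover {
    fix \<rho> R :: real and K :: "'a \<Rightarrow> real"
    assume R: "0 < R" and K: "K \<in> kernels s lam Lam \<rho>"
    let ?f = "\<lambda>y::'a. profile s (norm y / R)"
    let ?near = "{y::'a. 0 < norm y \<and> norm y < R}" and ?far = "{y::'a. R \<le> norm y}"
    have near: "(\<integral>\<^sup>+y. ennreal (?f y * K y) * indicator ?near y \<partial>lebesgue)
        \<le> ennreal (Lam * (R powr (- 2 * s) * N))"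
    proof (rule kernel_annuli_sum[OF K, where r = "\<lambda>k. R / 2 ^ Suc k" and c = "\<lambda>k. (1 / 2 ^ k) powr \<alpha>"])
      have "(1 / 2 ^ k) powr \<alpha> * (R / 2 ^ Suc k) powr (- 2 * s)
          = R powr (- 2 * s) * 2 powr (2 * s) * (2 powr (2 * s - \<alpha>)) ^ k" for k
      proof -
        have "(1 / 2 ^ k) powr \<alpha> = 2 powr (- real k * \<alpha>)"
          by (simp add: powr_realpow[symmetric] powr_minus_divide[symmetric] powr_powr)
        moreover have "R / 2 ^ Suc k = R * 2 powr (- real (Suc k))"
          using powr_realpow[of 2 "Suc k"] by (simp only: powr_minus_divide) simp
        moreover have "(2 powr (2 * s - \<alpha>)) ^ k = 2 powr ((2 * s - \<alpha>) * real k)"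
          using powr_realpow[of "2 powr (2 * s - \<alpha>)" k] by (simp add: powr_powr)
        ultimately have "(1 / 2 ^ k) powr \<alpha> * (R / 2 ^ Suc k) powr (- 2 * s) =
            R powr (- 2 * s) * (2 powr (- real k * \<alpha>) * 2 powr (- real (Suc k) * (- 2 * s)))"
          using R by (simp add: powr_mult powr_powr)
        also have "2 powr (- real k * \<alpha>) * 2 powr (- real (Suc k) * (- 2 * s))
            = 2 powr (2 * s) * 2 powr ((2 * s - \<alpha>) * real k)"
          unfolding powr_add[symmetric] by (simp add: algebra_simps)
        finally show ?thesis using \<open>(2 powr (2 * s - \<alpha>)) ^ k = _\<close> by simp
      qed
      then show "(\<lambda>k. (1 / 2 ^ k) powr \<alpha> * (R / 2 ^ Suc k) powr (- 2 * s)) sums (R powr (- 2 * s) * N)"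
        using sums_geometric_powr[OF \<alpha>(1), of "R powr (- 2 * s) * 2 powr (2 * s)"]
          by (simp add: N_def mult.assoc)
      fix y :: 'a assume "y \<in> ?near"
      then have y: "0 < norm y / R" "norm y / R < 1" using R by auto
      obtain k where k: "1 / 2 ^ Suc k \<le> norm y / R" "norm y / R < 1 / 2 ^ k"
        using dyadic_block_below[OF y] by blast
      have "?f y = (norm y / R) powr \<alpha>" using y by (simp only: profile_def \<alpha>_def if_True)
      also have "\<dots> \<le> (1 / 2 ^ k) powr \<alpha>" using y k \<alpha> by (intro powr_mono2) auto
      finally have "?f y \<le> (1 / 2 ^ k) powr \<alpha>" .
      then show "\<exists>k. R / 2 ^ Suc k \<le> norm y \<and> norm y < 2 * (R / 2 ^ Suc k) \<and> ?f y \<le> (1 / 2 ^ k) powr \<alpha>"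
        using k R by (intro exI[of _ k]) (auto simp: field_simps)
    qed (use R Lam in auto)
    have far: "(\<integral>\<^sup>+y. ennreal (?f y * K y) * indicator ?far y \<partial>lebesgue)
        \<le> ennreal (Lam * (R powr (- 2 * s) * F))"
    proof (rule kernel_annuli_sum[OF K, where r = "\<lambda>k. R * 2 ^ k" and c = "\<lambda>k. (2 ^ Suc k) powr \<beta>"])
      have "(2 ^ Suc k) powr \<beta> * (R * 2 ^ k) powr (- 2 * s)
          = R powr (- 2 * s) * 2 powr \<beta> * (2 powr (\<beta> - 2 * s)) ^ k" for k
      proof -
        have "(2 ^ Suc k) powr \<beta> = 2 powr (real (Suc k) * \<beta>)"
          using powr_realpow[of 2 "Suc k"] by (metis powr_powr zero_less_numeral)
        moreover have "(R * 2 ^ k) powr (- 2 * s) = R powr (- 2 * s) * 2 powr (real k * (- 2 * s))"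
          using powr_realpow[of 2 k] R by (metis powr_powr powr_mult zero_less_numeral)
        moreover have "(2 powr (\<beta> - 2 * s)) ^ k = 2 powr ((\<beta> - 2 * s) * real k)"
          using powr_realpow[of "2 powr (\<beta> - 2 * s)" k] by (simp add: powr_powr)
        moreover have "2 powr (real (Suc k) * \<beta>) * 2 powr (real k * (- 2 * s))
            = 2 powr \<beta> * 2 powr ((\<beta> - 2 * s) * real k)"
          unfolding powr_add[symmetric] by (simp add: algebra_simps)
        ultimately show ?thesis by simp
      qed
      then show "(\<lambda>k. (2 ^ Suc k) powr \<beta> * (R * 2 ^ k) powr (- 2 * s)) sums (R powr (- 2 * s) * F)"
        using sums_geometric_powr[OF \<beta>(1), of "R powr (- 2 * s) * 2 powr \<beta>"]
          by (simp add: F_def mult.assoc)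
      fix y :: 'a assume "y \<in> ?far"
      then have y: "1 \<le> norm y / R" using R by auto
      obtain k where k: "2 ^ k \<le> norm y / R" "norm y / R < 2 ^ Suc k" using dyadic_block_above[OF y]
        by blast
      have "\<not> norm y / R < 1" using y by simp
      then have "?f y = (norm y / R) powr \<beta>" by (simp only: profile_def \<beta>_def if_False)
      also have "\<dots> \<le> (2 ^ Suc k) powr \<beta>" using y k(2) \<beta> by (intro powr_mono2) auto
      finally have "?f y \<le> (2 ^ Suc k) powr \<beta>" .
      then show "\<exists>k. R * 2 ^ k \<le> norm y \<and> norm y < 2 * (R * 2 ^ k) \<and> ?f y \<le> (2 ^ Suc k) powr \<beta>"
        using k R by (intro exI[of _ k]) (auto simp: field_simps)
    qed (use R Lam in auto)
    have fm: "(\<lambda>y. ?f y) \<in> borel_measurable lebesgue" by (intro measurable_completion) measurable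
    have m: "(\<lambda>y. ?f y * K y) \<in> borel_measurable lebesgue"
      using fm kernels_measurable[OF K] by measurable
    have sets: "?near \<in> sets lebesgue" "?far \<in> sets lebesgue"
      by (auto intro!: sets_completionI_sets)
    have "(\<integral>\<^sup>+y. ennreal (?f y * K y) \<partial>lebesgue)
        = (\<integral>\<^sup>+y. ennreal (?f y * K y) * indicator ?near y + ennreal (?f y * K y) * indicator ?far y \<partial>lebesgue)"
    proof (intro nn_integral_cong)
      fix y :: 'a
      show "ennreal (?f y * K y) = ennreal (?f y * K y) * indicator ?near y
          + ennreal (?f y * K y) * indicator ?far y"
        using R by (cases "y = 0"; cases "norm y < R") (auto simp: profile_def)
    qed
    also have "\<dots> = (\<integral>\<^sup>+y. ennreal (?f y * K y) * indicator ?near y \<partial>lebesgue)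
        + (\<integral>\<^sup>+y. ennreal (?f y * K y) * indicator ?far y \<partial>lebesgue)"
    proof (intro nn_integral_add)
      have ind: "(indicator S :: 'a \<Rightarrow> ennreal) \<in> borel_measurable lebesgue" if "S \<in> sets lebesgue" for S
        using that by (intro borel_measurable_indicator)
      note m' = measurable_compose[OF m measurable_ennreal]
      show "(\<lambda>y. ennreal (?f y * K y) * indicator ?near y) \<in> borel_measurable lebesgue"
        "(\<lambda>y. ennreal (?f y * K y) * indicator ?far y) \<in> borel_measurable lebesgue"
        by (intro borel_measurable_times_ennreal m' ind sets)+
    qed
    also have "\<dots> \<le> ennreal (Lam * (R powr (- 2 * s) * N)) + ennreal (Lam * (R powr (- 2 * s) * F))"
      by (rule add_mono[OF near far])
    also have "\<dots> = ennreal (Lam * (N + F) * R powr (- 2 * s))"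
      using pos Lam by (simp add: ennreal_plus[symmetric] algebra_simps del: ennreal_plus)
    finally have bound: "(\<integral>\<^sup>+y. ennreal (?f y * K y) \<partial>lebesgue)
        \<le> ennreal (Lam * (N + F) * R powr (- 2 * s))" .
    have nn: "0 \<le> ?f y * K y" for y using profile_nonneg kernels_nonneg[OF K]
      by (intro mult_nonneg_nonneg)
    have int: "integrable lebesgue (\<lambda>y. ?f y * K y)"
      using m bound nn by (intro integrableI_nonneg) (auto simp: le_less_trans)
    moreover have "(LINT y|lebesgue. ?f y * K y) \<le> Lam * (N + F) * R powr (- 2 * s)"
      using bound nn_integral_eq_integral[OF int] nn pos Lam by simp
    ultimately have "integrable lebesgue (\<lambda>y. ?f y * K y) \<and>
        (LINT y|lebesgue. ?f y * K y) \<le> Lam * (N + F) * R powr (- 2 * s)" by blast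
  }
  ultimately show ?thesis by blast
qed

lemma set_integrable_kernel_first_moment:
  fixes K :: "'a::euclidean_space \<Rightarrow> real"
  assumes s: "0 < s" "s < 1" and Lam: "0 < Lam" and K: "K \<in> kernels s lam Lam \<rho>" and "0 < a"
  shows "set_integrable lebesgue (ball 0 b - ball 0 a) (\<lambda>y. K y *\<^sub>R y)"
proof -
  obtain C where C: "\<And>R (K::'a \<Rightarrow> real). 0 < R \<Longrightarrow> K \<in> kernels s lam Lam \<rho> \<Longrightarrow>
        integrable lebesgue (\<lambda>y. profile s (norm y / R) * K y)"
    using kernel_profile_bound[OF s Lam, where lam = lam and 'a = 'a] by blast
  have int: "integrable lebesgue (\<lambda>y. b * (profile s (norm y / a) * K y))"
    by (intro integrable_mult_right C \<open>0 < a\<close> K)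
  have idm: "(\<lambda>y::'a. y) \<in> borel_measurable lebesgue" by (intro measurable_completion) measurable
  show ?thesis unfolding set_integrable_def
  proof (rule Bochner_Integration.integrable_bound[OF int])
    show "(\<lambda>y. indicat_real (ball 0 b - ball 0 a) y *\<^sub>R (K y *\<^sub>R y)) \<in> borel_measurable lebesgue"
      using kernels_measurable[OF K] idm
      by (intro borel_measurable_scaleR borel_measurable_indicator) auto
    have "norm (indicat_real (ball 0 b - ball 0 a) y *\<^sub>R (K y *\<^sub>R y))
        \<le> norm (b * (profile s (norm y / a) * K y))" for y
    proof (cases "y \<in> ball 0 b - ball 0 a")
      case True
      then have y: "norm y < b" "a \<le> norm y" by auto
      then have "0 \<le> b" using norm_ge_zero[of y] by linarith
      have p: "1 \<le> profile s (norm y / a)" using y \<open>0 < a\<close> by (intro profile_ge_1) simp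
      have "norm (indicat_real (ball 0 b - ball 0 a) y *\<^sub>R (K y *\<^sub>R y)) = norm y * (1 * K y)"
        using True kernels_nonneg[OF K, of y] by simp
      also have "\<dots> \<le> b * (profile s (norm y / a) * K y)"
        using y p kernels_nonneg[OF K, of y] by (intro mult_mono mult_right_mono) (auto simp: \<open>0 \<le> b\<close>)
      finally show ?thesis by simp
    qed simp
    then show "AE y in lebesgue. norm (indicat_real (ball 0 b - ball 0 a) y *\<^sub>R (K y *\<^sub>R y))
        \<le> norm (b * (profile s (norm y / a) * K y))"
      by simp
  qed
qed

text \<open>
  The cancellation condition concerns annuli of ratio two only. Removing such annuli
  from inside leaves one of ratio at most two, whose first moment is bounded by its mass. This bound is
  what makes the truncation radius 1 in the operator harmless for \<open>s = 1/2\<close> and arbitrary \<open>R\<close>.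
\<close>
lemma kernel_first_moment_bound:
  fixes K :: "'a::euclidean_space \<Rightarrow> real"
  assumes Lam: "0 < Lam" and K: "K \<in> kernels (1/2) lam Lam \<rho>" and ab: "0 < a" "a \<le> b"
  shows "norm (LINT y:ball 0 b - ball 0 a|lebesgue. K y *\<^sub>R y) \<le> 2 * Lam"
proof -
  note integ = set_integrable_kernel_first_moment[OF _ _ Lam K, simplified]
  have short: "norm (LINT y:ball 0 b - ball 0 a|lebesgue. K y *\<^sub>R y) \<le> 2 * Lam"
    if "0 < a" "b \<le> 2 * a" for a b
  proof -
    let ?g = "\<lambda>y. indicat_real (ball 0 b - ball 0 a) y *\<^sub>R (K y *\<^sub>R y)"
    have int: "integrable lebesgue ?g" using integ[OF \<open>0 < a\<close>] by (simp add: set_integrable_def)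
    have "ennreal (LINT y|lebesgue. norm (?g y)) = (\<integral>\<^sup>+y. ennreal (norm (?g y)) \<partial>lebesgue)"
      by (intro nn_integral_eq_integral[symmetric] integrable_norm int) auto
    also have "\<dots> \<le> (\<integral>\<^sup>+y. ennreal (2 * a) * (ennreal (K y) * indicator (ball 0 (2 * a)
        - ball 0 a) y) \<partial>lebesgue)"
    proof (rule nn_integral_mono)
      fix y :: 'a
      show "ennreal (norm (?g y)) \<le> ennreal (2 * a) * (ennreal (K y) * indicator (ball 0 (2 * a)
          - ball 0 a) y)"
      proof (cases "y \<in> ball 0 b - ball 0 a")
        case True
        then have y: "y \<in> ball 0 (2 * a) - ball 0 a" "norm y \<le> 2 * a" using that by auto
        have "norm (?g y) = norm y * K y" using True kernels_nonneg[OF K, of y] by simp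
        also have "\<dots> \<le> 2 * a * K y" by (intro mult_right_mono y kernels_nonneg[OF K])
        finally have "ennreal (norm (?g y)) \<le> ennreal (2 * a * K y)" by (rule ennreal_leI)
        also have "\<dots> = ennreal (2 * a) * ennreal (K y)"
          using that by (simp add: ennreal_mult kernels_nonneg[OF K])
        finally show ?thesis using y by simp
      qed simp
    qed
    also have "\<dots> = ennreal (2 * a) * (\<integral>\<^sup>+y. ennreal (K y) * indicator (ball 0 (2 * a)
        - ball 0 a) y \<partial>lebesgue)"
    proof (intro nn_integral_cmult)
      have "(indicator (ball 0 (2 * a) - ball 0 a) :: 'a \<Rightarrow> ennreal) \<in> borel_measurable lebesgue"
        by (intro borel_measurable_indicator) auto
      then show "(\<lambda>y. ennreal (K y) * indicator (ball 0 (2 * a)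
          - ball 0 a) y) \<in> borel_measurable lebesgue"
        using kernels_measurable[OF K] by measurable
    qed
    also have "\<dots> \<le> ennreal (2 * a) * ennreal (Lam * a powr (- 2 * (1/2)))"
      using kernels_annulus[OF K \<open>0 < a\<close>] by (intro mult_left_mono) auto
    also have "\<dots> = ennreal (2 * Lam)"
      using that Lam by (simp add: ennreal_mult[symmetric] powr_minus divide_simps)
    finally have "(LINT y|lebesgue. norm (?g y)) \<le> 2 * Lam" using Lam by simp
    then show ?thesis
      unfolding set_lebesgue_integral_def using integral_norm_bound[of lebesgue ?g] by linarith
  qed
  have zero: "(LINT y:ball 0 (2 * a) - ball 0 a|lebesgue. K y *\<^sub>R y) = 0" if "0 < a" for a
    using K that by (simp add: kernels_def)
  have "norm (LINT y:ball 0 b - ball 0 a|lebesgue. K y *\<^sub>R y) \<le> 2 * Lam"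
    if "0 < a" "b \<le> 2 ^ Suc n * a" for a n
    using that
  proof (induction n arbitrary: a)
    case 0
    then show ?case using short by simp
  next
    case (Suc n)
    show ?case
    proof (cases "b \<le> 2 * a")
      case True
      then show ?thesis using short Suc by blast
    next
      case False
      have "ball 0 b - ball (0::'a) a = (ball 0 (2 * a) - ball 0 a) \<union> (ball 0 b - ball 0 (2 * a))"
        using False Suc(2) by auto
      then have "(LINT y:ball 0 b - ball 0 a|lebesgue. K y *\<^sub>R y) =
          (LINT y:ball 0 (2 * a) - ball 0 a|lebesgue. K y *\<^sub>R y) + (LINT y:ball 0 b - ball 0 (2 * a)|lebesgue. K y *\<^sub>R y)"
        using integ Suc(2) by (simp add: set_integral_Un disjoint_iff)
      then show ?thesis using zero[OF Suc(2)] Suc.IH[of "2 * a"] Suc(2,3) by (simp add: mult_ac)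
    qed
  qed
  moreover obtain n where "b / a < 2 ^ n" using real_arch_pow[of 2 "b / a"] by auto
  then have "b \<le> 2 ^ Suc n * a" using ab by (simp add: field_simps)
  ultimately show ?thesis using ab by blast
qed

section \<open>The weight and the bump\<close>

definition weight :: "real \<Rightarrow> real \<Rightarrow> 'a::euclidean_space \<Rightarrow> real" where
  "weight s R x = (2 * (R + norm x)) powr (- (real DIM('a) + 2 * s))"

text \<open>
  The square gives the bump a gradient of the order of its own square root, and makes it a convex
  function of \<open>1 - |x|\<^sup>2/R\<^sup>2\<close> even across the boundary of the ball.
\<close>
definition bump :: "real \<Rightarrow> 'a::euclidean_space \<Rightarrow> real" where
  "bump R x = (max 0 (1 - (norm x / R)\<^sup>2))\<^sup>2"

definition bump_grad :: "real \<Rightarrow> 'a::euclidean_space \<Rightarrow> 'a" where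
  "bump_grad R x = (- 4 * (1 - (norm x / R)\<^sup>2) / R\<^sup>2) *\<^sub>R x"

text \<open>
  Truncating the gradient at the scale \<open>R\<close> of the cylinder, and not at radius 1, makes all the estimates
  for increments scale invariant.
\<close>
definition grad_cutoff :: "real \<Rightarrow> real \<Rightarrow> 'a::euclidean_space \<Rightarrow> real" where
  "grad_cutoff s R y = (if s < 1/2 then 0 else if s = 1/2 then indicator (ball 0 R) y else 1)"

lemma weight_measurable [measurable]: "weight s R \<in> borel_measurable borel"
  unfolding weight_def by measurable

lemma bump_measurable [measurable]: "bump R \<in> borel_measurable borel"
  unfolding bump_def by measurable

lemma weight_nonneg: "0 \<le> weight s R x"
  by (simp add: weight_def)

lemma weight_le:
  assumes "0 < R" "0 < s" shows "weight s R (x::'a::euclidean_space)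
      \<le> (2 * R) powr (- (real DIM('a) + 2 * s))"
  unfolding weight_def using assms by (intro powr_mono2') auto

lemma bump_nonneg: "0 \<le> bump R x"
  by (simp add: bump_def)

lemma bump_le_1: "bump R x \<le> 1"
  unfolding bump_def by (intro power_le_one) auto

lemma bump_eq_0: "R > 0 \<Longrightarrow> R \<le> norm x \<Longrightarrow> bump R x = 0"
  by (simp add: bump_def max_def) (simp add: field_simps power2_eq_square mult_mono antisym)

lemma bump_inside: "norm x < R \<Longrightarrow> bump R x = (1 - (norm x / R)\<^sup>2)\<^sup>2"
  and bump_base_pos: "norm x < R \<Longrightarrow> 0 < 1 - (norm x / R)\<^sup>2"
proof -
  assume x: "norm x < R"
  then have "R > 0" using norm_ge_zero[of x] by linarith
  then have "(norm x / R)\<^sup>2 < 1" using x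
    by (intro power_less_one_iff[THEN iffD2]) (auto simp: abs_square_less_1)
  then show "bump R x = (1 - (norm x / R)\<^sup>2)\<^sup>2" "0 < 1 - (norm x / R)\<^sup>2" by (auto simp: bump_def)
qed

lemma bump_ge_half_ball:
  assumes "norm x \<le> R / 2" "0 < R" shows "9 / 16 \<le> bump R x"
proof -
  have "norm x / R \<le> 1 / 2" using assms by (simp add: field_simps)
  then have "(norm x / R)\<^sup>2 \<le> (1/2)\<^sup>2" using assms by (intro power_mono) auto
  then have "3/4 \<le> 1 - (norm x / R)\<^sup>2" by (simp add: power2_eq_square)
  then have "3/4 \<le> max 0 (1 - (norm x / R)\<^sup>2)" by (rule max.coboundedI2)
  then have "(3/4)\<^sup>2 \<le> bump R x" unfolding bump_def by (rule power_mono) simp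
  then show ?thesis by (simp add: power2_eq_square)
qed

text \<open>
  Both \<open>|y|\<close> and \<open>\<rho>\<close> are at most \<open>2 (R + |x + y|)\<close>. The weight depends on the end point of a jump only, so
  that integrating it in \<open>y\<close> gives the same quantity for every starting point \<open>x\<close>.
\<close>
lemma weight_le_kernel:
  fixes K :: "'a::euclidean_space \<Rightarrow> real" and x y :: 'a and R \<rho> :: real
  assumes K: "K \<in> kernels s lam Lam \<rho>" and "0 \<le> \<rho>" "\<rho> < R" "0 < s" "0 < lam"
    and x: "norm x < R" and "y \<noteq> 0"
  shows "lam * weight s R (x + y) \<le> K y"
proof -
  have "norm y \<le> norm (x + y) + norm x" by (metis add_diff_cancel_left' norm_triangle_ineq4)
  then have "norm y \<le> R + norm (x + y)" using x by linarith
  then have "norm y \<le> 2 * (R + norm (x + y))" using norm_ge_zero[of y] unfolding mult_2 by linarith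
  then have 1: "weight s R (x + y) \<le> norm y powr (- real DIM('a) - 2 * s)"
    unfolding weight_def using \<open>y \<noteq> 0\<close> \<open>0 < s\<close>
    by (simp add: powr_mono2' del: distrib_left_numeral)
  have 2: "weight s R (x + y) \<le> \<rho> powr (- real DIM('a) - 2 * s)" if "\<rho> \<noteq> 0"
  proof -
    have "\<rho> \<le> R + norm (x + y)" using assms(3) norm_ge_zero[of "x+y"] by linarith
    then have "\<rho> \<le> 2 * (R + norm (x + y))" using assms(2) unfolding mult_2 by linarith
    then show ?thesis unfolding weight_def using that assms
      by (simp add: powr_mono2' del: distrib_left_numeral)
  qed
  have "weight s R (x + y) \<le> kernel_lower s \<rho> y" using 1 2 by (simp add: kernel_lower_def)
  then have "lam * weight s R (x + y) \<le> lam * kernel_lower s \<rho> y" using \<open>0 < lam\<close> by simp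
  also have "\<dots> \<le> K y" using K \<open>y \<noteq> 0\<close> by (simp add: kernels_def)
  finally show ?thesis .
qed

lemma lebesgue_integral_shift:
  fixes f :: "'a::euclidean_space \<Rightarrow> real"
  assumes [measurable]: "f \<in> borel_measurable borel" and f: "integrable lebesgue f"
  shows "integrable lebesgue (\<lambda>y. f (x + y))" "(LINT y|lebesgue. f (x + y)) = (LINT y|lebesgue. f y)"
proof -
  have int: "integrable (distr lborel borel ((+) x)) f"
    using f by (simp add: integrable_completion lborel_distr_plus)
  then show "integrable lebesgue (\<lambda>y. f (x + y))"
    by (simp add: integrable_completion integrable_distr_eq)
  have "(LINT y|lborel. f (x + y)) = integral\<^sup>L (distr lborel borel ((+) x)) f"
    by (rule integral_distr[symmetric]) auto
  then show "(LINT y|lebesgue. f (x + y)) = (LINT y|lebesgue. f y)"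
    by (simp add: integral_completion lborel_distr_plus)
qed

lemma integrable_indicator_ball: "integrable lebesgue (indicator (ball (x::'a::euclidean_space) r) :: 'a \<Rightarrow> real)"
  by (rule integrable_real_indicator) (use lmeasurable_ball[of x r] in \<open>auto simp: fmeasurable_def\<close>)

lemma weight_powr_cancel:
  assumes "0 < R" "0 < k"
  shows "(k * R) powr (- (real n + 2 * s)) * R ^ n = k powr (- (real n + 2 * s)) * R powr (- 2 * s)"
proof -
  have "R powr (- (real n + 2 * s)) * R ^ n = R powr (- (real n + 2 * s)) * R powr real n"
    using assms by (simp add: powr_realpow)
  also have "\<dots> = R powr (- 2 * s)" unfolding powr_add[symmetric] by simp
  finally show ?thesis using assms by (simp add: powr_mult)
qed

text \<open>
  Outside the ball the weight is at most \<open>1 / lam\<close> times any kernel of the class, and the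
  tails of kernels have already been estimated; so nonemptiness of the class yields the integrability of the weight.
\<close>
lemma weight_integral_bound:
  fixes s lam Lam :: real
  assumes s: "0 < s" "s < 1" and lam: "0 < lam" and Lam: "0 < Lam"
  shows "\<exists>C>0. \<forall>\<rho> R. 0 \<le> \<rho> \<longrightarrow> \<rho> < R \<longrightarrow> (kernels s lam Lam \<rho> :: ('a::euclidean_space \<Rightarrow> real) set) \<noteq> {} \<longrightarrow>
        integrable lebesgue (weight s R :: 'a \<Rightarrow> real) \<and>
        (LINT x|lebesgue. weight s R (x::'a)) \<le> C * R powr (- 2 * s)"
proof -
  obtain C where C: "0 < C"
    "\<And>\<rho> R (K::'a \<Rightarrow> real). 0 < R \<Longrightarrow> K \<in> kernels s lam Lam \<rho> \<Longrightarrow>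
        integrable lebesgue (\<lambda>y. profile s (norm y / R) * K y) \<and>
        (LINT y|lebesgue. profile s (norm y / R) * K y) \<le> C * R powr (- 2 * s)"
    using kernel_profile_bound[OF s Lam, where lam = lam and 'a = 'a] by blast
  define n where "n = real DIM('a) + 2 * s"
  define V where "V = unit_ball_vol (real DIM('a))"
  have V: "0 < V" by (simp add: V_def)
  have "0 < C / lam + V" using C lam V by (simp add: add_pos_pos)
  moreover {
    fix \<rho> R :: real
    assume \<rho>: "0 \<le> \<rho>" "\<rho> < R" and ne: "(kernels s lam Lam \<rho> :: ('a \<Rightarrow> real) set) \<noteq> {}"
    then obtain K :: "'a \<Rightarrow> real" where K: "K \<in> kernels s lam Lam \<rho>" by auto
    have R: "0 < R" using \<rho> by simp
    let ?m = "\<lambda>y::'a. (1 / lam) * (profile s (norm y / R) * K y)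
        + (2 * R) powr (- n) * indicator (ball 0 R) y"
    have pt: "weight s R y \<le> ?m y" for y :: 'a
    proof (cases "norm y < R")
      case True
      then show ?thesis
        using weight_le[OF R s(1), of y] lam profile_nonneg[of s "norm y / R"] kernels_nonneg[OF K, of y]
        by (auto simp: n_def intro: add_increasing)
    next
      case False
      then have "y \<noteq> 0" using R by auto
      then have "lam * weight s R (0 + y) \<le> K y"
        using weight_le_kernel[OF K \<rho> s(1) lam, of 0 y] R by simp
      then have "weight s R y \<le> 1 / lam * (1 * K y)" using lam by (simp add: field_simps)
      also have "\<dots> \<le> (1 / lam) * (profile s (norm y / R) * K y)"
        using False R lam
          by (intro mult_left_mono mult_right_mono profile_ge_1 kernels_nonneg[OF K]) auto
      finally show ?thesis by (simp add: add_increasing2)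
    qed
    have b: "integrable lebesgue (indicator (ball 0 R) :: 'a \<Rightarrow> real)"
      by (rule integrable_indicator_ball)
    have int: "integrable lebesgue ?m"
      using C(2)[OF R K] b by (intro Bochner_Integration.integrable_add integrable_mult_right) auto
    have wint: "integrable lebesgue (weight s R :: 'a \<Rightarrow> real)"
      by (rule Bochner_Integration.integrable_bound[OF int])
         (auto intro!: measurable_completion AE_I2 order_trans[OF pt] simp: weight_nonneg)
    have "(LINT x|lebesgue. weight s R (x::'a)) \<le> (LINT x|lebesgue. ?m x)"
      by (intro integral_mono wint int pt)
    also have "\<dots> = (1 / lam) * (LINT y|lebesgue. profile s (norm y / R) * K y)
        + (2 * R) powr (- n) * measure lebesgue (ball (0::'a) R)"
      using C(2)[OF R K] b by (simp add: Bochner_Integration.integral_add integrable_mult_right)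
    also have "\<dots> \<le> (1 / lam) * (C * R powr (- 2 * s)) + V * R powr (- 2 * s)"
    proof (intro add_mono mult_left_mono)
      have "(2 * R) powr (- n) * measure lebesgue (ball (0::'a) R)
          = V * ((2 * R) powr (- n) * R ^ DIM('a))"
        using R by (simp add: V_def content_ball)
      also have "\<dots> = V * (2 powr (- n) * R powr (- 2 * s))"
        using weight_powr_cancel[OF R, of 2 "DIM('a)" s] by (simp add: n_def)
      also have "\<dots> \<le> V * (1 * R powr (- 2 * s))"
        using V powr_mono[of "-n" 0 2] s by (intro mult_left_mono mult_right_mono) (auto simp: n_def)
      finally show "(2 * R) powr (- n) * measure lebesgue (ball (0::'a) R) \<le> V * R powr (- 2 * s)"
        by simp
    qed (use C(2)[OF R K] lam in auto)
    finally have "integrable lebesgue (weight s R :: 'a \<Rightarrow> real) \<and>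
        (LINT x|lebesgue. weight s R (x::'a)) \<le> (C / lam + V) * R powr (- 2 * s)"
      using wint by (simp add: algebra_simps)
  }
  ultimately show ?thesis by blast
qed

text \<open>
  This is the fixed part of the nonlocal gain, available even at points where the bump is
  small.
\<close>
lemma weight_bump_integral_bound:
  fixes s :: real
  assumes s: "0 < s"
  shows "\<exists>c>0. \<forall>R. 0 < R \<longrightarrow> integrable lebesgue (weight s R :: 'a::euclidean_space \<Rightarrow> real) \<longrightarrow>
        integrable lebesgue (\<lambda>x::'a. weight s R x * bump R x) \<and>
        c * R powr (- 2 * s) \<le> (LINT x|lebesgue. weight s R (x::'a) * bump R x)"
proof -
  define n where "n = real DIM('a) + 2 * s"
  define V where "V = unit_ball_vol (real DIM('a))"
  have V: "0 < V" by (simp add: V_def)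
  have "0 < 9/16 * V * 4 powr (- n) / 2 ^ DIM('a)" using V by simp
  moreover {
    fix R :: real assume R: "0 < R" and w: "integrable lebesgue (weight s R :: 'a \<Rightarrow> real)"
    have int: "integrable lebesgue (\<lambda>x::'a. weight s R x * bump R x)"
    proof (rule Bochner_Integration.integrable_bound[OF w])
      show "(\<lambda>x::'a. weight s R x * bump R x) \<in> borel_measurable lebesgue"
        by (intro measurable_completion) measurable
      show "AE x::'a in lebesgue. norm (weight s R x * bump R x) \<le> norm (weight s R x)"
        using bump_le_1 by (auto intro!: AE_I2 mult_left_le simp: weight_nonneg bump_nonneg)
    qed
    have b: "integrable lebesgue (\<lambda>x::'a. (4 * R) powr (- n) * (9/16) * indicator (ball 0 (R/2)) x)"
      by (intro integrable_mult_right integrable_indicator_ball)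
    have "9/16 * V * 4 powr (- n) / 2 ^ DIM('a) * R powr (- 2 * s)
        = 9/16 * V / 2 ^ DIM('a) * ((4 * R) powr (- n) * R ^ DIM('a))"
      using weight_powr_cancel[OF R, of 4 "DIM('a)" s] by (simp add: n_def)
    also have "\<dots> = (4 * R) powr (- n) * (9/16) * measure lebesgue (ball (0::'a) (R/2))"
      using R by (simp add: content_ball V_def power_divide)
    also have "\<dots> = (LINT x::'a|lebesgue. (4 * R) powr (- n) * (9/16) * indicator (ball 0 (R/2)) x)"
      by simp
    also have "\<dots> \<le> (LINT x|lebesgue. weight s R (x::'a) * bump R x)"
    proof (intro integral_mono b int)
      fix x :: 'a
      show "(4 * R) powr (- n) * (9/16) * indicator (ball 0 (R/2)) x \<le> weight s R x * bump R x"
      proof (cases "x \<in> ball 0 (R/2)")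
        case True
        then have "norm x \<le> R / 2" by simp
        then have "(4 * R) powr (- n) \<le> weight s R x"
          unfolding weight_def n_def using R s by (intro powr_mono2') (auto intro: add_pos_nonneg)
        then show ?thesis
          using bump_ge_half_ball[of x R] True R mult_mono[of "(4 * R) powr (- n)" "weight s R x" "9/16" "bump R x"]
            by (simp add: weight_nonneg)
      qed (simp add: weight_nonneg bump_nonneg)
    qed
    finally have "integrable lebesgue (\<lambda>x::'a. weight s R x * bump R x) \<and>
        9/16 * V * 4 powr (- n) / 2 ^ DIM('a) * R powr (- 2 * s) \<le> (LINT x|lebesgue. weight s R (x::'a) * bump R x)"
      using int by blast
  }
  ultimately show ?thesis by blast
qed

text \<open>
  The remainder of the first-order expansion of \<open>z \<mapsto> z\<^sub>+\<^sup>2\<close> at \<open>p\<close>.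
\<close>
lemma square_pos_part_remainder:
  fixes p q :: real
  assumes "0 < p"
  shows "0 \<le> (max 0 q)\<^sup>2 - p\<^sup>2 - 2 * p * (q - p)"
    and "(max 0 q)\<^sup>2 / 2 - p\<^sup>2 \<le> (max 0 q)\<^sup>2 - p\<^sup>2 - 2 * p * (q - p)"
    and "(max 0 q)\<^sup>2 - p\<^sup>2 - 2 * p * (q - p) \<le> (q - p)\<^sup>2"
proof -
  have "0 \<le> (q - p)\<^sup>2" "0 \<le> (q / 2 - p)\<^sup>2" "0 \<le> q\<^sup>2" "0 \<le> p\<^sup>2" by auto
  moreover have "p * q \<le> 0" if "q \<le> 0" using that assms by (simp add: mult_nonneg_nonpos)
  ultimately have nn: "0 \<le> (q - p)\<^sup>2" "0 \<le> (q - 2 * p)\<^sup>2" "0 \<le> q\<^sup>2" "0 \<le> p\<^sup>2" "q \<le> 0 \<Longrightarrow> p * q \<le> 0"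
    by auto
  show "0 \<le> (max 0 q)\<^sup>2 - p\<^sup>2 - 2 * p * (q - p)"
  proof (cases "q \<le> 0")
    case True
    have "2 * p * (q - p) = 2 * (p * q) - 2 * p\<^sup>2" by (simp add: power2_eq_square algebra_simps)
    moreover have "(max 0 q)\<^sup>2 = 0" using True by simp
    ultimately show ?thesis using nn(4) nn(5)[OF True] by linarith
  next
    case False
    then show ?thesis using nn(1) by (simp add: power2_eq_square algebra_simps)
  qed
  show "(max 0 q)\<^sup>2 / 2 - p\<^sup>2 \<le> (max 0 q)\<^sup>2 - p\<^sup>2 - 2 * p * (q - p)"
  proof (cases "q \<le> 0")
    case True
    have "2 * p * (q - p) = 2 * (p * q) - 2 * p\<^sup>2" by (simp add: power2_eq_square algebra_simps)
    moreover have "(max 0 q)\<^sup>2 = 0" using True by simp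
    ultimately show ?thesis using nn(4) nn(5)[OF True] by linarith
  next
    case False
    then show ?thesis using nn(2) by (simp add: power2_eq_square algebra_simps)
  qed
  have "- (2 * p * q) + p\<^sup>2 \<le> (q - p)\<^sup>2" by (simp add: power2_diff)
  then show "(max 0 q)\<^sup>2 - p\<^sup>2 - 2 * p * (q - p) \<le> (q - p)\<^sup>2"
    by (cases "q \<le> 0") (auto simp: max_def power2_eq_square algebra_simps)
qed

lemma profile_eq:
  assumes "0 \<le> Y"
  shows "profile s Y = (if Y < 1 then if s < 1/2 then Y else Y\<^sup>2 else if s \<le> 1/2 then 1 else Y)"
  using assms by (auto simp: profile_def)

text \<open>
  Everything depends on the two numbers \<open>p\<close> and \<open>q\<close> that are squared in \<open>\<psi>(x)\<close> and \<open>\<psi>(x + y)\<close>. Since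
  \<open>z \<mapsto> z\<^sub>+\<^sup>2\<close> is convex, the increment of \<open>\<psi>\<close> minus its linear part is a nonnegative remainder minus
  \<open>2 p |y|\<^sup>2/R\<^sup>2\<close>, and the gradient also has size \<open>O(p)\<close>: the negative part is of order \<open>p\<close>, uniformly up
  to the boundary. By the second claim the remainder retains half of \<open>\<psi>(x + y)\<close>. The third claim serves
  integrability only.
\<close>
lemma bump_increment:
  fixes x y :: "'a::euclidean_space" and s R :: real
  assumes x: "norm x < R"
  defines "p \<equiv> 1 - (norm x / R)\<^sup>2"
  defines "D \<equiv> bump R (x + y) - bump R x - (y \<bullet> bump_grad R x) * grad_cutoff s R y"
  shows "0 \<le> D + 6 * p * profile s (norm y / R)"
    and "bump R (x + y) / 2 - p\<^sup>2 \<le> D + 6 * p * profile s (norm y / R)"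
    and "norm y < R \<Longrightarrow> \<bar>D\<bar> \<le> 13 * profile s (norm y / R)"
proof -
  have R: "0 < R" using x norm_ge_zero[of x] by linarith
  define Y where "Y = norm y / R"
  define z where "z = (x \<bullet> y) / R\<^sup>2"
  define q where "q = p - 2 * z - Y\<^sup>2"
  have Y: "0 \<le> Y" using R by (simp add: Y_def)
  have p: "0 < p" "p \<le> 1" using bump_base_pos[OF x] by (auto simp: p_def)
  have "\<bar>x \<bullet> y\<bar> \<le> norm x * norm y" by (rule Cauchy_Schwarz_ineq2)
  also have "\<dots> \<le> R * norm y" using x by (intro mult_right_mono) auto
  finally have z: "\<bar>z\<bar> \<le> Y" using R
    by (simp add: z_def Y_def divide_simps power2_eq_square abs_mult mult.commute)
  have q: "1 - (norm (x + y) / R)\<^sup>2 = q"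
  proof -
    have "(norm (x + y))\<^sup>2 = (norm x)\<^sup>2 + 2 * (x \<bullet> y) + (norm y)\<^sup>2"
      unfolding power2_norm_eq_inner by (simp add: inner_add_left inner_add_right inner_commute)
    then show ?thesis by (simp add: q_def p_def z_def Y_def power_divide add_divide_distrib)
  qed
  have bx: "bump R x = p\<^sup>2" using bump_inside[OF x] by (simp add: p_def)
  have bxy: "bump R (x + y) = (max 0 q)\<^sup>2" by (simp add: bump_def q)
  have g: "y \<bullet> bump_grad R x = - 4 * p * z"
    by (simp add: bump_grad_def p_def z_def inner_commute)
  define rem where "rem = (max 0 q)\<^sup>2 - p\<^sup>2 - 2 * p * (q - p)"
  note rem = square_pos_part_remainder[OF p(1), of q, folded rem_def]
  define a b c where "a = p * z" and "b = p * Y\<^sup>2" and "c = p * Y"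
  have ac: "a \<le> c" "- a \<le> c" using z p mult_left_mono[of z Y p] mult_left_mono[of "- z" Y p]
    by (auto simp: a_def c_def abs_le_iff)
  have D: "D = rem - 2 * b - 4 * a + 4 * a * grad_cutoff s R y"
    unfolding D_def bx bxy g rem_def q_def a_def b_def by (simp add: algebra_simps)
  have cut: "grad_cutoff s R y = (if s < 1/2 then 0 else if s
      = 1/2 then (if Y < 1 then 1 else 0) else 1)"
    using R by (auto simp: grad_cutoff_def Y_def)
  have near: "Y\<^sup>2 \<le> Y" if "Y < 1" using that Y by (simp add: power2_eq_square mult_left_le)
  have bc: "b \<le> c" if "Y < 1" using near[OF that] p by (simp add: b_def c_def)
  have b: "0 \<le> b" "b \<le> Y\<^sup>2" and c: "0 \<le> c" "c \<le> Y"
    using p Y by (auto simp: b_def c_def mult_left_le_one_le)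
  have prof: "6 * p * profile s Y = (if Y < 1 then if s < 1/2 then 6 * c else 6 * b else if s
      \<le> 1/2 then 6 * p else 6 * c)"
    unfolding profile_eq[OF Y] b_def c_def by simp
  have main: "rem \<le> D + 6 * p * profile s Y" if Y1: "Y < 1"
  proof (cases "s < 1/2")
    case True
    then show ?thesis using ac bc[OF Y1] c Y1 unfolding D cut prof by simp
  next
    case False
    then show ?thesis using b Y1 unfolding D cut prof by simp
  qed
  have far: "(max 0 q)\<^sup>2 \<le> D + 6 * p * profile s Y" if Y1: "\<not> Y < 1"
  proof -
    have pp: "p\<^sup>2 \<le> p" using p by (simp add: power2_eq_square mult_left_le)
    have pc: "p \<le> c" using Y1 p by (simp add: c_def)
    have D': "D = (max 0 q)\<^sup>2 - p\<^sup>2 + 4 * a * grad_cutoff s R y"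
      unfolding D_def bx bxy g a_def by simp
    show ?thesis
    proof (cases "s \<le> 1/2")
      case True
      then show ?thesis using pp p Y1 unfolding D' cut prof by simp
    next
      case False
      then show ?thesis using pp pc ac p Y1 unfolding D' cut prof by simp
    qed
  qed
  have "0 \<le> D + 6 * p * profile s Y \<and> bump R (x + y) / 2 - p\<^sup>2 \<le> D + 6 * p * profile s Y"
  proof (cases "Y < 1")
    case True
    then show ?thesis using main rem(1,2) bxy by simp
  next
    case False
    have "0 \<le> (max 0 q)\<^sup>2" "0 \<le> p\<^sup>2" by simp_all
    then show ?thesis using far[OF False] unfolding bxy by linarith
  qed
  then show "0 \<le> D + 6 * p * profile s (norm y / R)"
    and "bump R (x + y) / 2 - p\<^sup>2 \<le> D + 6 * p * profile s (norm y / R)" by (auto simp: Y_def)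
  assume "norm y < R"
  then have Y1: "Y < 1" using R by (simp add: Y_def)
  have "\<bar>q - p\<bar> \<le> 3 * Y" using z near[OF Y1] zero_le_power2[of Y] unfolding q_def by linarith
  then have "(q - p)\<^sup>2 \<le> (3 * Y)\<^sup>2" using power_mono[of "\<bar>q - p\<bar>" "3 * Y" 2] by simp
  then have r: "rem \<le> 9 * Y\<^sup>2" using rem(3) by (simp add: power_mult_distrib)
  show "\<bar>D\<bar> \<le> 13 * profile s (norm y / R)"
  proof (cases "s < 1/2")
    case True
    then show ?thesis using r rem(1) ac b c near[OF Y1] Y1
      unfolding D cut Y_def[symmetric] profile_eq[OF Y]
      by (simp add: abs_le_iff)
  next
    case False
    then show ?thesis using r rem(1) b Y1 unfolding D cut Y_def[symmetric] profile_eq[OF Y]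
      by (simp add: abs_le_iff)
  qed
qed

section \<open>The operator at a touching point\<close>

lemma gradient_unique:
  assumes "GDERIV w x :> D" shows "gradient w x = D"
  unfolding gradient_def
proof (rule the_equality[where P = "\<lambda>D. GDERIV w x :> D", OF assms])
  fix D' assume "GDERIV w x :> D'"
  then have "(\<lambda>h. h \<bullet> D') = (\<lambda>h. h \<bullet> D)"
    using assms unfolding gderiv_def by (rule has_derivative_unique)
  then have "(D' - D) \<bullet> (D' - D) = 0" by (metis (no_types) inner_diff_right right_minus_eq)
  then show "D' = D" by simp
qed

lemma GDERIV_bump:
  fixes x :: "'a::euclidean_space"
  assumes x: "norm x < R"
  shows "GDERIV (bump R) x :> bump_grad R x"
proof -
  have R: "0 < R" using x norm_ge_zero[of x] by linarith
  have "((\<lambda>x::'a. (1 - c * (x \<bullet> x))\<^sup>2) has_derivative (\<lambda>h. h \<bullet> ((- 4 * (1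
      - c * (x \<bullet> x)) * c) *\<^sub>R x))) (at x)" for c
    by (auto intro!: derivative_eq_intros simp: inner_commute algebra_simps)
  from this[of "1 / R\<^sup>2"]
  have "((\<lambda>x::'a. (1 - (x \<bullet> x) / R\<^sup>2)\<^sup>2) has_derivative (\<lambda>h. h \<bullet> bump_grad R x)) (at x)"
    unfolding bump_grad_def power_divide power2_norm_eq_inner by simp
  moreover have "open (ball (0::'a) R)" by simp
  ultimately show ?thesis unfolding gderiv_def
    by (rule has_derivative_transform_within_open)
       (use x in \<open>auto simp: bump_inside power_divide power2_norm_eq_inner\<close>)
qed

lemma norm_bump_grad:
  assumes "norm x < R"
  shows "norm (bump_grad R x) \<le> 4 * (1 - (norm x / R)\<^sup>2) / R"
proof -
  have R: "0 < R" using assms norm_ge_zero[of x] by linarith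
  have p: "0 < 1 - (norm x / R)\<^sup>2" by (rule bump_base_pos[OF assms])
  have "norm (bump_grad R x) = 4 * (1 - (norm x / R)\<^sup>2) / R\<^sup>2 * norm x"
    using p R by (simp add: bump_grad_def abs_mult)
  also have "\<dots> \<le> 4 * (1 - (norm x / R)\<^sup>2) / R\<^sup>2 * R"
    using p R assms by (intro mult_left_mono) auto
  also have "\<dots> = 4 * (1 - (norm x / R)\<^sup>2) / R" using R by (simp add: power2_eq_square)
  finally show ?thesis .
qed

lemma profile_mono:
  assumes "0 \<le> Y" "Y \<le> Z" "Z < 1" shows "profile s Y \<le> profile s Z"
  using assms by (simp add: profile_eq power_mono)

lemma integrable_weight_times_bounded:
  fixes f :: "'a::euclidean_space \<Rightarrow> real"
  assumes w: "integrable lebesgue (weight s R :: 'a \<Rightarrow> real)"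
    and [measurable]: "f \<in> borel_measurable borel" and f: "\<And>x. \<bar>f x\<bar> \<le> B"
  shows "integrable lebesgue (\<lambda>x. weight s R x * f x)"
proof (rule Bochner_Integration.integrable_bound[OF integrable_mult_right[OF w, of B]])
  show "(\<lambda>x. weight s R x * f x) \<in> borel_measurable lebesgue"
    by (intro measurable_completion) measurable
  have "norm (weight s R x * f x) \<le> norm (B * weight s R x)" for x
  proof -
    have "norm (weight s R x * f x) = \<bar>f x\<bar> * weight s R x" by (simp add: abs_mult weight_nonneg)
    also have "\<dots> \<le> B * weight s R x" by (intro mult_right_mono f weight_nonneg)
    finally show ?thesis by simp
  qed
  then show "AE x in lebesgue. norm (weight s R x * f x) \<le> norm (B * weight s R x)" by simp
qed

text \<open>
  The situation at a touching point, at a fixed time: \<open>U\<close> is the supersolution, and \<open>v\<close> is the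
  function in the definition of viscosity solutions, equal to the test function \<open>\<theta> \<psi> - q\<close> on the ball
  around \<open>x0\<close> and to \<open>U\<close> elsewhere. The lowered barrier \<open>\<theta> \<psi> - q\<close> lies below \<open>v\<close> globally.
\<close>
locale touching =
  fixes s lam Lam \<rho> R \<theta> q \<epsilon> M :: real and x0 :: "'a::euclidean_space" and K v U :: "'a \<Rightarrow> real"
  assumes s: "0 < s" "s < 1" and lam: "0 < lam" and Lam: "0 < Lam"
    and \<rho>: "0 \<le> \<rho>" "\<rho> < R" and K: "K \<in> kernels s lam Lam \<rho>"
    and x0: "norm x0 < R" and \<epsilon>: "0 < \<epsilon>" "\<epsilon> \<le> R" and \<theta>: "0 \<le> \<theta>" and q: "0 \<le> q"
    and v_meas [measurable]: "v \<in> borel_measurable borel"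
    and U_meas [measurable]: "U \<in> borel_measurable borel"
    and U: "\<And>x. 0 \<le> U x" "\<And>x. U x \<le> M"
    and v_near: "\<And>x. x \<in> ball x0 \<epsilon> \<Longrightarrow> v x = \<theta> * bump R x - q"
    and v_ge: "\<And>x. \<theta> * bump R x - q \<le> v x"
    and v_far: "\<And>x. x \<notin> ball x0 \<epsilon> \<Longrightarrow> v x = U x"
begin

definition "p = 1 - (norm x0 / R)\<^sup>2"
definition "G = \<theta> *\<^sub>R bump_grad R x0"
definition "incr y = v (x0 + y) - v x0 - (y \<bullet> G) * grad_cutoff s R y"

lemma R: "0 < R" using \<rho> by simp

lemma p: "0 < p" "p \<le> 1" "bump R x0 = p\<^sup>2"
  using bump_base_pos[OF x0] bump_inside[OF x0] by (auto simp: p_def)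

lemma gradient_v: "gradient v x0 = G"
proof (rule gradient_unique)
  have "((\<lambda>x. \<theta> * bump R x - q) has_derivative (\<lambda>h. h \<bullet> G)) (at x0)"
    using GDERIV_bump[OF x0] unfolding gderiv_def G_def
    by (auto intro!: derivative_eq_intros)
  then show "GDERIV v x0 :> G" unfolding gderiv_def
    by (rule has_derivative_transform_within_open[OF _ open_ball[of x0 \<epsilon>]]) (use \<epsilon> v_near in auto)
qed

lemma abs_v: "\<bar>v x\<bar> \<le> M + \<theta> + q"
proof (cases "x \<in> ball x0 \<epsilon>")
  case True
  have "\<theta> * bump R x \<le> \<theta>" using \<theta> bump_le_1 by (intro mult_left_le) auto
  moreover have "0 \<le> \<theta> * bump R x" using \<theta> by (simp add: bump_nonneg)
  ultimately show ?thesis using U[of x] q \<theta> v_near[OF True] by linarith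
next
  case False
  then show ?thesis using U[of x] q \<theta> v_far[OF False] by linarith
qed

lemma incr_near:
  assumes "norm y < \<epsilon>"
  shows "incr y = \<theta> * (bump R (x0 + y) - bump R x0 - (y \<bullet> bump_grad R x0) * grad_cutoff s R y)"
proof -
  have "x0 + y \<in> ball x0 \<epsilon>" "x0 \<in> ball x0 \<epsilon>" using assms \<epsilon> by (auto simp: dist_norm)
  from this[THEN v_near] show ?thesis unfolding incr_def G_def by (simp add: algebra_simps)
qed

text \<open>
  Comparing with the profile at radius \<open>\<epsilon>\<close> instead of \<open>R\<close> treats the smooth part near \<open>x0\<close> and
  the merely bounded part away from it at the same time.
\<close>
lemma abs_incr: "\<bar>incr y\<bar> \<le> (13 * \<theta> + 2 * (M + \<theta> + q) + R * norm G) * profile s (norm y / \<epsilon>)"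
proof (cases "norm y < \<epsilon>")
  case True
  have B: "0 \<le> 2 * (M + \<theta> + q) + R * norm G" using U[of x0] q \<theta> R by (simp add: add_nonneg_nonneg)
  have "\<bar>incr y\<bar> \<le> \<theta> * (13 * profile s (norm y / R))"
    unfolding incr_near[OF True] abs_mult using \<theta> bump_increment(3)[OF x0, of y s] True \<epsilon>
    by (simp add: mult_left_mono)
  also have "\<dots> \<le> \<theta> * (13 * profile s (norm y / \<epsilon>))"
    using True \<epsilon> R \<theta> by (intro mult_left_mono profile_mono) (auto simp: frac_le)
  also have "\<dots> = 13 * \<theta> * profile s (norm y / \<epsilon>)" by simp
  also have "\<dots> \<le> (13 * \<theta> + 2 * (M + \<theta> + q) + R * norm G) * profile s (norm y / \<epsilon>)"
    using B by (intro mult_right_mono profile_nonneg) simp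
  finally show ?thesis .
next
  case False
  let ?P = "profile s (norm y / \<epsilon>)"
  have Y: "1 \<le> norm y / \<epsilon>" using False \<epsilon> by simp
  have P: "1 \<le> ?P" using Y by (rule profile_ge_1)
  have cut: "norm y * \<bar>grad_cutoff s R y\<bar> \<le> R * ?P"
  proof -
    have "R \<le> R * ?P" using P R by simp
    moreover have "norm y = \<epsilon> * (norm y / \<epsilon>)" using \<epsilon> by simp
    then have "norm y \<le> R * (norm y / \<epsilon>)" using \<epsilon> by (metis mult_right_mono Y order_trans zero_le_one)
    ultimately show ?thesis using Y R profile_nonneg[of s "norm y / \<epsilon>"]
      by (auto simp: grad_cutoff_def profile_eq indicator_def)
  qed
  have "\<bar>(y \<bullet> G) * grad_cutoff s R y\<bar> \<le> norm y * norm G * \<bar>grad_cutoff s R y\<bar>"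
    unfolding abs_mult by (intro mult_right_mono Cauchy_Schwarz_ineq2) auto
  also have "\<dots> \<le> R * norm G * ?P" using mult_right_mono[OF cut, of "norm G"] by (simp add: mult_ac)
  finally have 1: "\<bar>(y \<bullet> G) * grad_cutoff s R y\<bar> \<le> R * norm G * ?P" .
  have B: "0 \<le> M + \<theta> + q" using U[of x0] q \<theta> by simp
  have "\<bar>incr y\<bar> \<le> 2 * (M + \<theta> + q) + R * norm G * ?P"
    using abs_v[of "x0 + y"] abs_v[of x0] 1 unfolding incr_def abs_le_iff mult_2 by linarith
  also have "\<dots> \<le> 2 * (M + \<theta> + q) * ?P + R * norm G * ?P"
    using mult_left_mono[OF P, of "2 * (M + \<theta> + q)"] B by (intro add_right_mono) simp
  also have "\<dots> \<le> (13 * \<theta> + 2 * (M + \<theta> + q) + R * norm G) * ?P"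
    using P \<theta> by (simp add: algebra_simps)
  finally show ?thesis .
qed

lemma grad_cutoff_measurable [measurable]: "grad_cutoff s R \<in> borel_measurable borel"
proof -
  consider "s < 1/2" | "s = 1/2" | "s > 1/2" by linarith
  then show ?thesis by cases (auto simp: grad_cutoff_def[abs_def] intro!: borel_measurable_indicator)
qed

lemma integrable_incr: "integrable lebesgue (\<lambda>y. incr y * K y)"
proof -
  have "integrable lebesgue (\<lambda>y::'a. profile s (norm y / \<epsilon>) * K y)"
    using kernel_profile_bound[OF s Lam, where lam = lam and 'a = 'a] \<epsilon>(1) K by blast
  then have int: "integrable lebesgue (\<lambda>y. (13 * \<theta> + 2 * (M + \<theta> + q)
      + R * norm G) * (profile s (norm y / \<epsilon>) * K y))"
    by (rule integrable_mult_right)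
  show ?thesis
  proof (rule Bochner_Integration.integrable_bound[OF int])
    have "incr \<in> borel_measurable borel" unfolding incr_def[abs_def] by measurable
    then have "incr \<in> borel_measurable lebesgue" by (simp add: measurable_completion)
    then show "(\<lambda>y. incr y * K y) \<in> borel_measurable lebesgue"
      by (intro borel_measurable_times kernels_measurable[OF K])
    have "norm (incr y * K y) \<le> norm ((13 * \<theta> + 2 * (M + \<theta> + q)
        + R * norm G) * (profile s (norm y / \<epsilon>) * K y))" for y
    proof -
      have "norm (incr y * K y) = \<bar>incr y\<bar> * K y" using kernels_nonneg[OF K] by (simp add: abs_mult)
      also have "\<dots> \<le> (13 * \<theta> + 2 * (M + \<theta> + q) + R * norm G) * profile s (norm y / \<epsilon>) * K y"
        by (intro mult_right_mono abs_incr kernels_nonneg[OF K])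
      also have "\<dots> \<le> norm ((13 * \<theta> + 2 * (M + \<theta> + q) + R * norm G) * (profile s (norm y / \<epsilon>) * K y))"
        by (simp add: mult.assoc)
      finally show ?thesis .
    qed
    then show "AE y in lebesgue. norm (incr y * K y)
        \<le> norm ((13 * \<theta> + 2 * (M + \<theta> + q) + R * norm G) * (profile s (norm y / \<epsilon>) * K y))"
      by simp
  qed
qed

text \<open>
  For \<open>s = 1/2\<close> the operator truncates the gradient term at radius 1 instead of \<open>R\<close>. The difference is
  a first moment of \<open>K\<close> over an annulus, applied to a gradient of size \<open>O(\<theta> p / R)\<close>.
\<close>
lemma L_op_ge_incr: "(LINT y|lebesgue. incr y * K y) - 8 * Lam * \<theta> * p * R powr (- 2 * s)
    \<le> L_op s K v x0"
proof (cases "s = 1/2")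
  case False
  have "delta s y v x0 = incr y" for y
    using False by (auto simp: delta_def incr_def gradient_v grad_cutoff_def)
  then have "L_op s K v x0 = (LINT y|lebesgue. incr y * K y)" by (simp add: L_op_def)
  then show ?thesis using Lam \<theta> p by simp
next
  case True
  have K': "K \<in> kernels (1/2) lam Lam \<rho>" using K True by simp
  \<comment> \<open>The sign depends on which of the two truncation radii is the larger one.\<close>
  define sg where "sg = (if 1 \<le> R then 1 else - 1 :: real)"
  define A where "A = (if 1 \<le> R then ball 0 R - ball 0 1 else ball 0 1 - ball (0::'a) R)"
  have intA: "integrable lebesgue (\<lambda>y. indicat_real A y *\<^sub>R (K y *\<^sub>R y))"
    using set_integrable_kernel_first_moment[OF s Lam K R, of 1] set_integrable_kernel_first_moment[OF s Lam K zero_less_one, of R]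
    by (auto simp: set_integrable_def A_def)
  have bound: "norm (LINT y|lebesgue. indicat_real A y *\<^sub>R (K y *\<^sub>R y)) \<le> 2 * Lam"
    using kernel_first_moment_bound[OF Lam K', of 1 R] kernel_first_moment_bound[OF Lam K' R, of 1]
    by (auto simp: set_lebesgue_integral_def A_def)
  have eq: "delta s y v x0 * K y = incr y * K y + sg * ((indicat_real A y *\<^sub>R (K y *\<^sub>R y)) \<bullet> G)" for y
    using True by (auto
      simp: delta_def incr_def gradient_v grad_cutoff_def sg_def A_def indicator_def algebra_simps)
  have "L_op s K v x0 = (LINT y|lebesgue. incr y * K y)
      + sg * ((LINT y|lebesgue. indicat_real A y *\<^sub>R (K y *\<^sub>R y)) \<bullet> G)"
  proof -
    have intG: "integrable lebesgue (\<lambda>y. (indicat_real A y *\<^sub>R (K y *\<^sub>R y)) \<bullet> G)"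
      by (rule integrable_inner_left) (rule intA)
    have "L_op s K v x0 = (LINT y|lebesgue. incr y * K y)
        + (LINT y|lebesgue. sg * ((indicat_real A y *\<^sub>R (K y *\<^sub>R y)) \<bullet> G))"
      unfolding L_op_def eq
        by (intro Bochner_Integration.integral_add integrable_incr integrable_mult_right intG)
    also have "(LINT y|lebesgue. sg * ((indicat_real A y *\<^sub>R (K y *\<^sub>R y)) \<bullet> G))
        = sg * (LINT y|lebesgue. (indicat_real A y *\<^sub>R (K y *\<^sub>R y)) \<bullet> G)"
      by (rule integral_mult_right_zero)
    also have "(LINT y|lebesgue. (indicat_real A y *\<^sub>R (K y *\<^sub>R y)) \<bullet> G)
        = (LINT y|lebesgue. indicat_real A y *\<^sub>R (K y *\<^sub>R y)) \<bullet> G"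
      by (rule integral_inner_left) (rule intA)
    finally show ?thesis .
  qed
  moreover have "\<bar>sg * ((LINT y|lebesgue. indicat_real A y *\<^sub>R (K y *\<^sub>R y)) \<bullet> G)\<bar>
      \<le> 8 * Lam * \<theta> * p * R powr (- 2 * s)"
  proof -
    have "\<bar>sg * ((LINT y|lebesgue. indicat_real A y *\<^sub>R (K y *\<^sub>R y)) \<bullet> G)\<bar>
        = \<bar>(LINT y|lebesgue. indicat_real A y *\<^sub>R (K y *\<^sub>R y)) \<bullet> G\<bar>" by (simp add: sg_def)
    also have "\<dots> \<le> 2 * Lam * norm G"
      by (rule order_trans[OF Cauchy_Schwarz_ineq2 mult_right_mono[OF bound]]) simp
    also have "\<dots> \<le> 2 * Lam * (\<theta> * (4 * p / R))"
      using mult_left_mono[OF norm_bump_grad[OF x0] \<theta>] \<theta> Lam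
      by (intro mult_left_mono) (simp_all add: G_def p_def)
    also have "\<dots> = 8 * Lam * \<theta> * p * R powr (- 2 * s)"
    proof -
      have e: "- 2 * s = - 1" using True by simp
      have "R powr (- 2 * s) = 1 / R" unfolding e using R by (simp add: powr_minus_divide)
      then show ?thesis by simp
    qed
    finally show ?thesis .
  qed
  ultimately show ?thesis by linarith
qed

text \<open>
  The increment of \<open>v\<close> is \<open>D + \<theta> E\<close>, where \<open>D \<ge> 0\<close> is the height of \<open>v\<close> above the touching function
  and \<open>E\<close> is the increment of the bump. Only a quarter of the kernel bound is applied to \<open>D \<ge> U - \<theta> \<psi>\<close>
  off the ball; the loss \<open>\<theta> \<psi>/4\<close> is then less than the gain \<open>\<theta> \<psi>/2\<close> from \<open>E\<close>, and a positive
  multiple of \<open>\<psi>\<close> remains.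
\<close>
lemma incr_kernel_ge:
  "lam / 4 * (weight s R (x0 + y) * U (x0 + y))
      - lam / 4 * M * (weight s R (x0 + y) * indicator (ball x0 \<epsilon>) (x0 + y))
     + \<theta> * (lam / 4 * (weight s R (x0 + y) * bump R (x0 + y)) - 6 * p * (profile s (norm y / R) * K y)
             - lam * p\<^sup>2 * weight s R (x0 + y)) \<le> incr y * K y"
proof -
  define w where "w = weight s R (x0 + y)"
  define b where "b = bump R (x0 + y)"
  define k where "k = K y"
  define i where "i = indicat_real (ball x0 \<epsilon>) (x0 + y)"
  define P where "P = profile s (norm y / R)"
  define u where "u = U (x0 + y)"
  have w: "0 \<le> w" by (simp add: w_def weight_nonneg)
  have k: "0 \<le> k" by (simp add: k_def kernels_nonneg[OF K])
  have b: "0 \<le> b" by (simp add: b_def bump_nonneg)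
  have P: "0 \<le> P" by (simp add: P_def profile_nonneg)
  have u: "0 \<le> u" "u \<le> M" using U by (auto simp: u_def)
  have "lam / 4 * (w * u) - lam / 4 * M * (w * i)
      + \<theta> * (lam / 4 * (w * b) - 6 * p * (P * k) - lam * p\<^sup>2 * w) \<le> incr y * k"
  proof (cases "y = 0")
    \<comment> \<open>Kernels have no lower bound at the origin; there the increment vanishes and the left-hand side is
      nonpositive.\<close>
    case True
    have i: "i = 1" using True \<epsilon> by (simp add: i_def)
    have P0: "P = 0" using True by (simp add: P_def profile_def)
    have b0: "b = p\<^sup>2" using True p(3) by (simp add: b_def)
    have "lam * (w * u) \<le> lam * (w * M)" using lam w u by (intro mult_left_mono) auto
    moreover have "0 \<le> \<theta> * (lam * (w * p\<^sup>2))" using \<theta> lam w by simp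
    moreover have "incr y = 0" using True by (simp add: incr_def)
    ultimately show ?thesis unfolding i P0 b0 by (simp add: algebra_simps)
  next
    case False
    have lw: "lam * w \<le> k" unfolding w_def k_def by (rule weight_le_kernel[OF K \<rho> s(1) lam x0 False])
    define D where "D = v (x0 + y) - (\<theta> * b - q)"
    have D: "0 \<le> D" using v_ge[of "x0 + y"] by (simp add: D_def b_def)
    have Du: "u - \<theta> * b - M * i \<le> D"
    proof (cases "x0 + y \<in> ball x0 \<epsilon>")
      case True
      have "0 \<le> \<theta> * b" using \<theta> b by simp
      then have "u - \<theta> * b - M * i \<le> 0" using True u by (simp add: i_def)
      then show ?thesis using D by linarith
    next
      case False
      then show ?thesis using v_far[OF False] q by (simp add: D_def i_def u_def)
    qed
    define E where "E = b - p\<^sup>2 - (y \<bullet> bump_grad R x0) * grad_cutoff s R y"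
    have E: "0 \<le> E + 6 * p * P" "b / 2 - p\<^sup>2 \<le> E + 6 * p * P"
      using bump_increment(1,2)[OF x0, where y = y and s = s]
        unfolding E_def b_def P_def p_def[symmetric] p(3) by auto
    have incr: "incr y = D + \<theta> * E"
    proof -
      have "v x0 = \<theta> * p\<^sup>2 - q" using v_near[of x0] \<epsilon> p(3) by simp
      then show ?thesis unfolding incr_def D_def E_def G_def by (simp add: algebra_simps)
    qed
    have "lam / 4 * w * (u - \<theta> * b - M * i) \<le> lam / 4 * w * D" using lam w Du
      by (intro mult_left_mono) auto
    also have "\<dots> \<le> lam * w * D" using lam w D by (intro mult_right_mono) auto
    also have "\<dots> \<le> k * D" using lw D by (rule mult_right_mono)
    finally have 1: "lam / 4 * w * (u - \<theta> * b - M * i) \<le> k * D" .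
    have "lam * w * (b / 2 - p\<^sup>2) \<le> lam * w * (E + 6 * p * P)" using lam w E(2)
      by (intro mult_left_mono) auto
    also have "\<dots> \<le> k * (E + 6 * p * P)" using lw E(1) by (rule mult_right_mono)
    finally have "\<theta> * (lam * w * (b / 2 - p\<^sup>2)) \<le> \<theta> * (k * (E + 6 * p * P))" using \<theta>
      by (rule mult_left_mono)
    moreover have "lam / 4 * w * (u - \<theta> * b - M * i) = lam / 4 * (w * u) - \<theta> * (lam / 4 * (w * b))
        - lam / 4 * M * (w * i)"
      "\<theta> * (lam * w * (b / 2 - p\<^sup>2)) = 2 * (\<theta> * (lam / 4 * (w * b))) - \<theta> * (lam * p\<^sup>2 * w)"
      "\<theta> * (k * (E + 6 * p * P)) = \<theta> * (k * E) + \<theta> * (6 * p * (P * k))"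
      "(D + \<theta> * E) * k = k * D + \<theta> * (k * E)"
      by (simp_all add: field_simps)
    ultimately show ?thesis using 1 unfolding incr right_diff_distrib[of \<theta>] by linarith
  qed
  then show ?thesis by (simp add: w_def b_def k_def i_def P_def u_def)
qed

lemma integral_incr_ge:
  assumes w: "integrable lebesgue (weight s R :: 'a \<Rightarrow> real)"
  shows "lam / 4 * ((LINT x|lebesgue. weight s R x * U x)
      - M * (LINT x|lebesgue. weight s R x * indicator (ball x0 \<epsilon>) x))
     + \<theta> * (lam / 4 * (LINT x|lebesgue. weight s R x * bump R (x::'a)) - 6 * p * (LINT y|lebesgue. profile s (norm y / R) * K y)
             - lam * p\<^sup>2 * (LINT x|lebesgue. weight s R (x::'a))) \<le> (LINT y|lebesgue. incr y * K y)"
proof -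
  have M: "0 \<le> M" using U[of x0] by simp
  have shift: "integrable lebesgue (\<lambda>y. weight s R (x0 + y) * f (x0 + y))"
    "(LINT y|lebesgue. weight s R (x0 + y) * f (x0 + y)) = (LINT x|lebesgue. weight s R x * f x)"
    if m[measurable]: "f \<in> borel_measurable borel" and f: "\<And>x. \<bar>f x\<bar> \<le> B" for f :: "'a \<Rightarrow> real" and B
    using lebesgue_integral_shift[of "\<lambda>x. weight s R x * f x" x0] integrable_weight_times_bounded[OF w m f] by auto
  have U1: "\<And>x. \<bar>U x\<bar> \<le> M" using U by simp
  have ib: "indicat_real (ball x0 \<epsilon>) \<in> borel_measurable borel"
    by (intro borel_measurable_indicator) simp
  have i1: "\<And>x. \<bar>indicat_real (ball x0 \<epsilon>) x\<bar> \<le> 1" by (simp add: indicator_def)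
  have b1: "\<And>x::'a. \<bar>bump R x\<bar> \<le> 1" by (simp add: abs_of_nonneg bump_nonneg bump_le_1)
  note sU = shift[OF U_meas U1] and si = shift[OF ib i1] and sb = shift[OF bump_measurable b1]
  have sw: "integrable lebesgue (\<lambda>y. weight s R (x0 + y))" "(LINT y|lebesgue. weight s R (x0 + y))
      = (LINT x|lebesgue. weight s R (x::'a))"
    using lebesgue_integral_shift[OF weight_measurable w] by auto
  have prof: "integrable lebesgue (\<lambda>y. profile s (norm y / R) * K y)"
    using kernel_profile_bound[OF s Lam, where lam = lam and 'a = 'a] R K by blast
  let ?f1 = "\<lambda>y. weight s R (x0 + y) * U (x0 + y)"
  let ?f2 = "\<lambda>y. weight s R (x0 + y) * indicator (ball x0 \<epsilon>) (x0 + y)"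
  let ?f3 = "\<lambda>y. weight s R (x0 + y) * bump R (x0 + y)"
  let ?f4 = "\<lambda>y. profile s (norm y / R) * K y"
  let ?f5 = "\<lambda>y. weight s R (x0 + y)"
  let ?g = "\<lambda>y. lam / 4 * ?f1 y - lam / 4 * M * ?f2 y
      + \<theta> * (lam / 4 * ?f3 y - 6 * p * ?f4 y - lam * p\<^sup>2 * ?f5 y)"
  have i2: "integrable lebesgue ?f2" "(LINT y|lebesgue. ?f2 y)
      = (LINT x|lebesgue. weight s R x * indicator (ball x0 \<epsilon>) x)"
    using si by auto
  have int: "has_bochner_integral lebesgue ?g (lam / 4 * (LINT y|lebesgue. ?f1 y)
      - lam / 4 * M * (LINT y|lebesgue. ?f2 y)
      + \<theta> * (lam / 4 * (LINT y|lebesgue. ?f3 y) - 6 * p * (LINT y|lebesgue. ?f4 y) - lam * p\<^sup>2 * (LINT y|lebesgue. ?f5 y)))"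
    by (intro has_bochner_integral_add has_bochner_integral_diff has_bochner_integral_mult_right
        has_bochner_integral_integrable sU(1) i2(1) sb(1) prof sw(1))
  have "(LINT y|lebesgue. ?g y) \<le> (LINT y|lebesgue. incr y * K y)"
    using int by (intro integral_mono integrable_incr incr_kernel_ge) (auto
      simp: has_bochner_integral_iff)
  then show ?thesis
    unfolding has_bochner_integral_integral_eq[OF int] sU(2) i2(2) sb(2) sw(2)
      by (simp add: algebra_simps)
qed

end

text \<open>
  The loss is linear in \<open>p\<close>, and the gain contains the constant \<open>c\<close>. Young's
  inequality turns the linear loss into that constant plus a multiple of \<open>p\<^sup>2 = \<psi>(x\<^sub>0)\<close>, which is the
  form that an exponential decay in time can absorb.
\<close>
lemma L_op_touching_lower_bound:
  fixes s lam Lam :: real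
  assumes s: "0 < s" "s < 1" and lam: "0 < lam" and Lam: "0 < Lam"
  shows "\<exists>C\<ge>0. \<forall>\<rho> R \<theta> q \<epsilon> M. \<forall>(x0::'a::euclidean_space) K v U.
      touching s lam Lam \<rho> R \<theta> q \<epsilon> M x0 K v U \<longrightarrow>
      lam / 4 * ((LINT x|lebesgue. weight s R x * U x) - M * (LINT x|lebesgue. weight s R x * indicator (ball x0 \<epsilon>) x))
        - C * bump R x0 * \<theta> * R powr (- 2 * s) \<le> L_op s K v x0"
proof -
  obtain CP where CP: "0 < CP"
    "\<And>\<rho> R (K::'a \<Rightarrow> real). 0 < R \<Longrightarrow> K \<in> kernels s lam Lam \<rho> \<Longrightarrow>
        integrable lebesgue (\<lambda>y. profile s (norm y / R) * K y) \<and>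
        (LINT y|lebesgue. profile s (norm y / R) * K y) \<le> CP * R powr (- 2 * s)"
    using kernel_profile_bound[OF s Lam, where lam = lam and 'a = 'a] by blast
  obtain CW where CW: "0 < CW"
    "\<And>\<rho> R. 0 \<le> \<rho> \<Longrightarrow> \<rho> < R \<Longrightarrow> (kernels s lam Lam \<rho> :: ('a \<Rightarrow> real) set) \<noteq> {} \<Longrightarrow>
        integrable lebesgue (weight s R :: 'a \<Rightarrow> real) \<and>
        (LINT x|lebesgue. weight s R (x::'a)) \<le> CW * R powr (- 2 * s)"
    using weight_integral_bound[OF s lam Lam, where 'a = 'a] by blast
  obtain c where c: "0 < c"
    "\<And>R. 0 < R \<Longrightarrow> integrable lebesgue (weight s R :: 'a \<Rightarrow> real) \<Longrightarrow>
        c * R powr (- 2 * s) \<le> (LINT x|lebesgue. weight s R (x::'a) * bump R x)"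
    using weight_bump_integral_bound[OF s(1), where 'a = 'a] by blast
  define A where "A = 6 * CP + 8 * Lam"
  define C where "C = lam * CW + A\<^sup>2 / (lam * c)"
  have "0 \<le> C" using lam CW c by (simp add: C_def)
  moreover have "lam / 4 * ((LINT x|lebesgue. weight s R x * U x)
      - M * (LINT x|lebesgue. weight s R x * indicator (ball x0 \<epsilon>) x))
        - C * bump R x0 * \<theta> * R powr (- 2 * s) \<le> L_op s K v x0"
    if "touching s lam Lam \<rho> R \<theta> q \<epsilon> M x0 K v U" for \<rho> R \<theta> q \<epsilon> M and x0 :: 'a and K v U
  proof -
    interpret touching s lam Lam \<rho> R \<theta> q \<epsilon> M x0 K v U by (rule that)
    have w: "integrable lebesgue (weight s R :: 'a \<Rightarrow> real)"
      and w2: "(LINT x|lebesgue. weight s R (x::'a)) \<le> CW * R powr (- 2 * s)"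
      using CW(2)[OF \<rho>] K by auto
    let ?r = "R powr (- 2 * s)"
    have r: "0 < ?r" using R by simp
    have "- C * p\<^sup>2 \<le> lam / 4 * c - A * p - lam * CW * p\<^sup>2"
    proof -
      have "0 \<le> (A * p / (lam * c) - 1 / 2)\<^sup>2 * (lam * c)" using lam c by simp
      also have "\<dots> = A\<^sup>2 * p\<^sup>2 / (lam * c) - A * p + lam * c / 4"
        using lam c by (simp add: power2_eq_square field_simps)
      finally show ?thesis by (simp add: C_def algebra_simps)
    qed
    then have "- C * p\<^sup>2 * ?r \<le> (lam / 4 * c - A * p - lam * CW * p\<^sup>2) * ?r"
      using r by (intro mult_right_mono) auto
    also have "\<dots> = lam / 4 * (c * ?r) - 6 * p * (CP * ?r) - lam * p\<^sup>2 * (CW * ?r) - 8 * Lam * p * ?r"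
      by (simp add: A_def algebra_simps)
    also have "\<dots> \<le> lam / 4 * (LINT x|lebesgue. weight s R x * bump R (x::'a))
        - 6 * p * (LINT y|lebesgue. profile s (norm y / R) * K y)
             - lam * p\<^sup>2 * (LINT x|lebesgue. weight s R (x::'a)) - 8 * Lam * p * ?r"
      using c(2)[OF R w] CP(2)[OF R K] w2 lam p
      by (intro diff_mono mult_left_mono order_refl) auto
    finally have "\<theta> * (- C * p\<^sup>2 * ?r)
        \<le> \<theta> * (lam / 4 * (LINT x|lebesgue. weight s R x * bump R (x::'a)) - 6 * p * (LINT y|lebesgue. profile s (norm y / R) * K y)
             - lam * p\<^sup>2 * (LINT x|lebesgue. weight s R (x::'a)) - 8 * Lam * p * ?r)"
      using \<theta> by (rule mult_left_mono)
    then show ?thesis using integral_incr_ge[OF w] L_op_ge_incr unfolding p(3)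
      by (simp add: algebra_simps)
  qed
  ultimately show ?thesis by blast
qed

section \<open>Comparison with the barrier\<close>

lemma left_deriv_unique:
  assumes "(g has_real_derivative D) (at_left t)" shows "left_deriv g t = D"
  unfolding left_deriv_def
  by (rule the_equality) (use assms in \<open>auto intro: has_field_derivative_unique\<close>)

lemma lipschitz_on_bump_grad:
  assumes R: "0 < R"
  shows "(12 / R\<^sup>2)-lipschitz_on (ball 0 R) (bump_grad R :: 'a::euclidean_space \<Rightarrow> 'a)"
proof (rule lipschitz_onI)
  fix x y :: 'a assume xy: "x \<in> ball 0 R" "y \<in> ball 0 R"
  define p where "p z = 1 - (norm z / R)\<^sup>2" for z :: 'a
  have nx: "norm x < R" "norm y < R" using xy by auto
  have p: "\<bar>p x\<bar> \<le> 1" using bump_base_pos[OF nx(1)] by (simp add: p_def)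
  have "p x - p y = (norm y - norm x) * (norm y + norm x) / R\<^sup>2"
    by (simp add: p_def power_divide diff_divide_distrib power2_eq_square algebra_simps)
  then have "\<bar>p x - p y\<bar> = \<bar>norm y - norm x\<bar> * (norm y + norm x) / R\<^sup>2"
    by (simp add: abs_mult)
  also have "\<dots> \<le> norm (x - y) * (2 * R) / R\<^sup>2"
    using nx norm_triangle_ineq3[of x y]
      by (intro divide_right_mono mult_mono) (auto simp: abs_minus_commute)
  also have "\<dots> = 2 * norm (x - y) / R" using R by (simp add: power2_eq_square)
  finally have pd: "\<bar>p x - p y\<bar> \<le> 2 * norm (x - y) / R" .
  have "norm (p x *\<^sub>R x - p y *\<^sub>R y) = norm (p x *\<^sub>R (x - y) + (p x - p y) *\<^sub>R y)"
    by (simp add: algebra_simps)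
  also have "\<dots> \<le> \<bar>p x\<bar> * norm (x - y) + \<bar>p x - p y\<bar> * norm y"
    by (rule order_trans[OF norm_triangle_ineq]) simp
  also have "\<dots> \<le> 1 * norm (x - y) + 2 * norm (x - y) / R * R"
    using p pd nx by (intro add_mono mult_mono) auto
  also have "\<dots> = 3 * norm (x - y)" using R by simp
  finally have main: "norm (p x *\<^sub>R x - p y *\<^sub>R y) \<le> 3 * norm (x - y)" .
  have "bump_grad R z = (- 4 / R\<^sup>2) *\<^sub>R (p z *\<^sub>R z)" for z
    by (simp only: bump_grad_def p_def scaleR_scaleR times_divide_eq_left)
  then have "bump_grad R x - bump_grad R y = (- 4 / R\<^sup>2) *\<^sub>R (p x *\<^sub>R x - p y *\<^sub>R y)"
    by (simp only: scaleR_diff_right)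
  then have "dist (bump_grad R x) (bump_grad R y) = 4 / R\<^sup>2 * norm (p x *\<^sub>R x - p y *\<^sub>R y)"
    by (simp add: dist_norm)
  also have "\<dots> \<le> 4 / R\<^sup>2 * (3 * norm (x - y))" by (intro mult_left_mono main) simp
  finally show "dist (bump_grad R x) (bump_grad R y) \<le> 12 / R\<^sup>2 * dist x y" by (simp add: dist_norm)
qed simp

lemma C11_on_scaled_bump:
  assumes "A \<subseteq> ball (0::'a::euclidean_space) R" "0 < R"
  shows "C11_on A (\<lambda>x. bump R x * k - c)"
proof -
  have D: "GDERIV (\<lambda>x. bump R x * k - c) x :> k *\<^sub>R bump_grad R x" if "x \<in> A" for x
  proof -
    have "norm x < R" using that assms by auto
    from GDERIV_bump[OF this] show ?thesis unfolding gderiv_def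
      by (auto intro!: derivative_eq_intros)
  qed
  have "(\<bar>k\<bar> * (12 / R\<^sup>2))-lipschitz_on A (gradient (\<lambda>x. bump R x * k - c))"
  proof (rule lipschitz_onI)
    fix x y assume xy: "x \<in> A" "y \<in> A"
    have "dist (k *\<^sub>R bump_grad R x) (k *\<^sub>R bump_grad R y) = \<bar>k\<bar> * dist (bump_grad R x) (bump_grad R y)"
      by (simp add: dist_norm scaleR_diff_right[symmetric])
    also have "\<dots> \<le> \<bar>k\<bar> * (12 / R\<^sup>2 * dist x y)"
      using xy assms by (intro mult_left_mono lipschitz_onD[OF lipschitz_on_bump_grad]) auto
    finally show "dist (gradient (\<lambda>x. bump R x * k - c) x) (gradient (\<lambda>x. bump R x * k - c) y)
        \<le> \<bar>k\<bar> * (12 / R\<^sup>2) * dist x y"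
      using gradient_unique[OF D[OF xy(1)]] gradient_unique[OF D[OF xy(2)]] by simp
  qed simp
  then show ?thesis unfolding C11_on_def using D by blast
qed

lemma Linf_slice_measurable:
  assumes "u \<in> Linf (UNIV \<times> I)" "t \<in> I"
  shows "(\<lambda>x::'a::euclidean_space. u (x, t)) \<in> borel_measurable borel"
proof -
  have u: "u \<in> borel_measurable (restrict_space borel (UNIV \<times> I))" using assms by (simp add: Linf_def)
  have "(\<lambda>x. (x, t)) \<in> measurable (borel :: 'a measure) (restrict_space borel (UNIV \<times> I))"
  proof (rule measurable_restrict_space2)
    show "(\<lambda>x. (x, t)) \<in> space borel \<rightarrow> UNIV \<times> I" using assms by auto
    show "(\<lambda>x. (x, t)) \<in> measurable (borel :: 'a measure) borel" 
      by (intro borel_measurable_continuous_onI continuous_intros)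
  qed
  from measurable_compose[OF this u] show ?thesis by simp
qed

lemma small_ball_weight_integral:
  fixes x0 :: "'a::euclidean_space"
  assumes R: "0 < R" and s: "0 < s" and \<eta>: "0 < \<eta>" and w: "integrable lebesgue (weight s R :: 'a \<Rightarrow> real)"
  shows "\<exists>e>0. \<forall>\<epsilon>. 0 < \<epsilon> \<longrightarrow> \<epsilon> \<le> e \<longrightarrow> (LINT x|lebesgue. weight s R x * indicator (ball x0 \<epsilon>) x) \<le> \<eta>"
proof -
  define W where "W = (2 * R) powr (- (real DIM('a) + 2 * s))"
  define V where "V = unit_ball_vol (real DIM('a))"
  have WV: "0 < W * V" using R by (simp add: W_def V_def)
  define e where "e = min 1 (\<eta> / (W * V))"
  have "(LINT x|lebesgue. weight s R x * indicator (ball x0 \<epsilon>) x) \<le> \<eta>" if \<epsilon>: "0 < \<epsilon>" "\<epsilon> \<le> e" for \<epsilon>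
  proof -
    have "(LINT x|lebesgue. weight s R x * indicator (ball x0 \<epsilon>) x)
        \<le> (LINT x|lebesgue. W * indicator (ball x0 \<epsilon>) x)"
    proof (intro integral_mono)
      show "integrable lebesgue (\<lambda>x. weight s R x * indicat_real (ball x0 \<epsilon>) x)"
        by (rule integrable_weight_times_bounded[OF w, where B = 1])
           (auto intro!: borel_measurable_indicator simp: indicator_def)
      show "integrable lebesgue (\<lambda>x. W * indicat_real (ball x0 \<epsilon>) x)"
        by (intro integrable_mult_right integrable_indicator_ball)
      show "weight s R x * indicat_real (ball x0 \<epsilon>) x \<le> W * indicat_real (ball x0 \<epsilon>) x" for x
        using weight_le[OF R s, of x] by (intro mult_right_mono) (auto simp: W_def)
    qed
    also have "\<dots> = W * V * \<epsilon> ^ DIM('a)"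
      using \<epsilon> by (simp add: V_def content_ball)
    also have "\<dots> \<le> W * V * \<epsilon>"
      using WV \<epsilon> power_decreasing[of 1 "DIM('a)" \<epsilon>] by (intro mult_left_mono) (auto simp: e_def)
    also have "\<dots> \<le> W * V * (\<eta> / (W * V))" using WV \<epsilon> by (intro mult_left_mono) (auto simp: e_def)
    also have "\<dots> = \<eta>" using WV by (metis less_irrefl nonzero_eq_divide_eq mult.commute)
    finally show ?thesis .
  qed
  moreover have "0 < e" using WV \<eta> by (simp add: e_def)
  ultimately show ?thesis by blast
qed

text \<open>
  If the barrier exceeded \<open>u\<close> somewhere, then \<open>u\<close> minus the barrier would have a negative
  global minimum, since the barrier is negative for \<open>t = -T\<close> and outside the ball. At this point the barrier,
  lowered by a constant and with \<open>H\<close> replaced by an affine function, is an admissible test function. The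
  lower bound on the operator contradicts the supersolution property; the parameter \<open>\<delta>\<close> makes the
  inequalities strict.
\<close>
lemma supersolution_above_barrier:
  fixes u :: "'a::euclidean_space \<times> real \<Rightarrow> real" and s lam Lam \<rho> R C M a \<delta> L :: real
  defines "T \<equiv> R powr (2 * s)"
  assumes s: "0 < s" "s < 1" and lam: "0 < lam" and Lam: "0 < Lam" and \<rho>: "0 \<le> \<rho>" "\<rho> < R"
    and a: "0 \<le> a" and \<delta>: "0 < \<delta>" and C: "0 \<le> C"
    and touch: "\<And>\<theta> q \<epsilon> M (x0::'a) K v U. touching s lam Lam \<rho> R \<theta> q \<epsilon> M x0 K v U \<Longrightarrow>
      lam / 4 * ((LINT x|lebesgue. weight s R x * U x) - M * (LINT x|lebesgue. weight s R x * indicator (ball x0 \<epsilon>) x))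
        - C * bump R x0 * \<theta> * R powr (- 2 * s) \<le> L_op s K v x0"
    and ne: "(kernels s lam Lam \<rho> :: ('a \<Rightarrow> real) set) \<noteq> {}"
    and w: "integrable lebesgue (weight s R :: 'a \<Rightarrow> real)"
    and super: "viscosity_super s lam Lam \<rho> (ball 0 R) (time_ivl s R) (\<lambda>_. - (R powr (- 2 * s)) * a) u"
    and u0: "\<And>x t. t \<in> time_ivl s R \<Longrightarrow> 0 \<le> u (x, t)"
    and uM: "\<And>x t. t \<in> time_ivl s R \<Longrightarrow> u (x, t) \<le> M"
    and H0: "\<And>t. t \<le> - T \<Longrightarrow> H t = 0" and Hmono: "mono H"
    and Hlip: "\<And>t t'. t \<le> t' \<Longrightarrow> H t' - H t \<le> L * (t' - t)"
    and slope: "\<And>t0. \<exists>\<epsilon>>0. \<forall>t\<in>{t0 - \<epsilon><..t0}. H t0 - H t \<le> g t0 * (t0 - t)"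
    and g: "\<And>t. t \<in> time_ivl s R \<Longrightarrow> 0 \<le> g t \<and> g t \<le> (LINT x|lebesgue. weight s R x * u (x, t))"
    and x: "x \<in> ball 0 R" and t: "t \<in> time_ivl s R"
  shows "bump R x * (exp (- C * (t + T) / T) * (lam / 4 * H t)) - (a + \<delta>) * (t + T) / T - \<delta> \<le> u (x, t)"
proof (rule ccontr)
  have R: "0 < R" using \<rho> by simp
  have T: "0 < T" using R by (simp add: T_def)
  have rT: "R powr (- 2 * s) = 1 / T" by (simp add: T_def powr_minus_divide)
  have I: "time_ivl s R = {- T<..0}" by (simp add: time_ivl_def T_def)
  define \<mu> where "\<mu> = lam / 4"
  have \<mu>: "0 < \<mu>" using lam by (simp add: \<mu>_def)
  define \<Theta> where "\<Theta> t = exp (- C * (t + T) / T) * (\<mu> * H t)" for t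
  define \<Phi> where "\<Phi> p = bump R (fst p) * \<Theta> (snd p) - (a + \<delta>) * (snd p + T) / T - \<delta>" for p :: "'a \<times> real"
  assume "\<not> ?thesis"
  then have neg: "u (x, t) < \<Phi> (x, t)" by (simp add: \<Phi>_def \<Theta>_def \<mu>_def)
  have Hnn: "0 \<le> H t" for t
  proof -
    have "H (min t (- T)) \<le> H t" by (rule monoD[OF Hmono]) simp
    then show ?thesis using H0[of "min t (- T)"] by simp
  qed
  have \<Theta>nn: "0 \<le> \<Theta> t" for t using \<mu> Hnn by (simp add: \<Theta>_def)
  have "L-lipschitz_on UNIV H"
  proof (rule lipschitz_onI)
    show "dist (H t) (H t') \<le> L * dist t t'" for t t'
      using Hlip[of t t'] Hlip[of t' t] monoD[OF Hmono, of t t'] monoD[OF Hmono, of t' t]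
      by (cases "t \<le> t'") (auto simp: dist_real_def abs_if)
    show "0 \<le> L" using Hlip[of 0 1] monoD[OF Hmono, of 0 1] by simp
  qed
  then have Hc: "continuous_on UNIV H" by (rule lipschitz_on_continuous_on)
  have bc: "continuous_on UNIV (bump R :: 'a \<Rightarrow> real)" unfolding bump_def
    by (intro continuous_intros) (use R in auto)
  have \<Theta>c: "continuous_on UNIV \<Theta>" unfolding \<Theta>_def by (intro continuous_intros Hc) (use T in auto)
  have \<Phi>c: "continuous_on UNIV \<Phi>" unfolding \<Phi>_def
    by (intro continuous_intros continuous_on_compose2[OF bc] continuous_on_compose2[OF \<Theta>c]) (use T in auto)
  have \<Phi>neg: "\<Phi> (y, r) < 0" if "R \<le> norm y \<or> r = - T" "- T \<le> r" for y r
  proof -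
    have "bump R y * \<Theta> r = 0" using that H0[of r] bump_eq_0[OF R, of y] by (auto simp: \<Theta>_def)
    moreover have "0 \<le> (a + \<delta>) * (r + T) / T" using that a \<delta> T by simp
    ultimately show ?thesis using \<delta> unfolding \<Phi>_def fst_conv snd_conv by linarith
  qed
  \<comment> \<open>The part of the closed cylinder where the barrier is nonnegative is compact, and it stays away from the
    parabolic boundary, where nothing is known about the semicontinuity of \<open>u\<close>.\<close>
  define S where "S = (cball 0 R \<times> {- T..0}) \<inter> {p. 0 \<le> \<Phi> p}"
  have "compact S" unfolding S_def
    by (intro compact_Int_closed compact_Times closed_Collect_le continuous_intros \<Phi>c) auto
  moreover have S_sub: "S \<subseteq> ball 0 R \<times> time_ivl s R"
  proof
    fix p assume "p \<in> S"
    then obtain y r where p: "p = (y, r)" "norm y \<le> R" "- T \<le> r" "r \<le> 0" "0 \<le> \<Phi> (y, r)"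
      by (auto simp: S_def)
    then have "norm y < R" "- T < r" using \<Phi>neg[of y r] by (auto simp: not_le intro: le_neq_trans)
    then show "p \<in> ball 0 R \<times> time_ivl s R" using p by (simp add: I)
  qed
  moreover have "lsc_on S (\<lambda>p. u p - \<Phi> p)"
    using super S_sub \<Phi>c unfolding viscosity_super_def
    by (intro lsc_on_diff_continuous) (auto intro: lsc_on_subset continuous_on_subset)
  moreover have xtS: "(x, t) \<in> S" using x t neg u0[of t x] by (auto simp: S_def I)
  ultimately obtain p0 where p0: "p0 \<in> S" "\<And>p. p \<in> S \<Longrightarrow> u p0 - \<Phi> p0 \<le> u p - \<Phi> p"
    using lsc_attains_min[of S "\<lambda>p. u p - \<Phi> p"] by blast
  obtain x0 t0 where xt0: "p0 = (x0, t0)" by (cases p0)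
  have x0: "norm x0 < R" and t0: "- T < t0" "t0 \<le> 0" and t0I: "t0 \<in> time_ivl s R"
    using p0(1) S_sub by (auto simp: xt0 I)
  define m where "m = \<Phi> (x0, t0) - u (x0, t0)"
  have m: "0 < m" using p0(2)[OF xtS] neg by (simp add: xt0 m_def)
  have below: "\<Phi> (y, r) - m \<le> u (y, r)" if r: "r \<in> time_ivl s R" for y r
  proof (cases "(y, r) \<in> S")
    case True
    then show ?thesis using p0(2)[OF True] by (simp add: xt0 m_def)
  next
    case False
    then have "R < norm y \<or> \<Phi> (y, r) < 0" using r by (auto simp: S_def I)
    then have "\<Phi> (y, r) < 0" using \<Phi>neg[of y r] r by (auto simp: I)
    then show ?thesis using m u0[OF r, of y] by simp
  qed
  have M: "0 \<le> M" using u0[OF t0I, of 0] uM[OF t0I, of 0] by simp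
  obtain \<epsilon>1 where \<epsilon>1: "0 < \<epsilon>1" "\<And>t. t \<in> {t0 - \<epsilon>1<..t0} \<Longrightarrow> H t0 - H t \<le> g t0 * (t0 - t)"
    using slope[of t0] by blast
  \<comment> \<open>On the ball where \<open>v\<close> is the test function there is no nonlocal gain. The ball is taken so small that
    this costs less than the strictness \<open>\<delta> / T\<close>.\<close>
  have "0 < \<delta> / (2 * T * (\<mu> * M + 1))" using \<delta> T \<mu> M by (simp add: add_nonneg_pos)
  from small_ball_weight_integral[OF R s(1) this w, of x0]
  obtain \<epsilon>2 where \<epsilon>2: "0 < \<epsilon>2" "\<And>\<epsilon>. 0 < \<epsilon> \<Longrightarrow> \<epsilon> \<le> \<epsilon>2 \<Longrightarrow>
      (LINT x|lebesgue. weight s R x * indicator (ball x0 \<epsilon>) x) \<le> \<delta> / (2 * T * (\<mu> * M + 1))" by blast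
  define \<epsilon> where "\<epsilon> = Min {\<epsilon>1, \<epsilon>2, R - norm x0, t0 + T}"
  have \<epsilon>: "0 < \<epsilon>" "\<epsilon> \<le> \<epsilon>1" "\<epsilon> \<le> \<epsilon>2" "\<epsilon> \<le> R - norm x0" "\<epsilon> \<le> t0 + T"
    using \<epsilon>1(1) \<epsilon>2(1) x0 t0 by (auto simp: \<epsilon>_def)
  let ?B = "ball x0 \<epsilon>" and ?J = "{t0 - \<epsilon><..t0}"
  have B: "?B \<subseteq> ball 0 R"
  proof
    fix y assume "y \<in> ?B"
    then show "y \<in> ball 0 R" using \<epsilon>(4) norm_triangle_ineq2[of y x0]
      by (simp add: dist_norm norm_minus_commute)
  qed
  have J: "?J \<subseteq> time_ivl s R" using \<epsilon>(5) t0 by (auto simp: I)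
  \<comment> \<open>Replacing \<open>H\<close> by an affine function that lies below it to the left of \<open>t0\<close> keeps the touching and makes the test function
    differentiable in time.\<close>
  define k where "k t = exp (- C * (t + T) / T) * (\<mu> * (H t0 + g t0 * (t - t0)))" for t
  define c where "c t = (a + \<delta>) * (t + T) / T + \<delta> + m" for t
  define \<phi> where "\<phi> p = bump R (fst p) * k (snd p) - c (snd p)" for p :: "'a \<times> real"
  define k' where "k' t = (- C / T) * k t + exp (- C * (t + T) / T) * (\<mu> * g t0)" for t
  have k_deriv: "(k has_real_derivative k' t) (at t)" for t
  proof -
    have e: "((\<lambda>t. exp (- C * (t + T) / T)) has_real_derivative (- C / T) * exp (- C * (t
        + T) / T)) (at t)"
      using T by (auto intro!: derivative_eq_intros)
    have "((\<lambda>t. \<mu> * (H t0 + g t0 * (t - t0))) has_real_derivative \<mu> * g t0) (at t)"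
      by (auto intro!: derivative_eq_intros)
    from DERIV_mult[OF e this] show ?thesis unfolding k_def k'_def by (simp add: mult_ac)
  qed
  have c_deriv: "(c has_real_derivative (a + \<delta>) / T) (at t)" for t
    unfolding c_def using T by (auto intro!: derivative_eq_intros)
  have \<phi>_deriv: "((\<lambda>\<tau>. \<phi> (y, \<tau>)) has_real_derivative bump R y * k' t - (a + \<delta>) / T) (at_left t)" for y t
    unfolding \<phi>_def fst_conv snd_conv
    by (rule has_field_derivative_at_within) (auto intro!: derivative_eq_intros k_deriv c_deriv)
  have test: "test_function ?B ?J \<phi>"
    unfolding test_function_def using \<phi>_deriv C11_on_scaled_bump[OF B R] by (auto simp: \<phi>_def)
  have k0: "k t0 = \<Theta> t0" by (simp add: k_def \<Theta>_def)
  have \<phi>0: "u (x0, t0) = \<phi> (x0, t0)" using k0 by (simp add: \<phi>_def c_def m_def \<Phi>_def)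
  have \<phi>_le: "\<phi> p \<le> u p" if pin: "p \<in> ?B \<times> ?J" for p
  proof -
    obtain y r where p: "p = (y, r)" "y \<in> ?B" "r \<in> ?J" using pin by (cases p) blast
    have "H t0 + g t0 * (r - t0) \<le> H r" using \<epsilon>1(2)[of r] p(3) \<epsilon>(2) by (auto simp: algebra_simps)
    then have "k r \<le> \<Theta> r" using \<mu> by (simp add: k_def \<Theta>_def)
    then have "bump R y * k r \<le> bump R y * \<Theta> r" using bump_nonneg by (rule mult_left_mono)
    then have "\<phi> p \<le> \<Phi> (y, r) - m" by (simp add: p \<phi>_def c_def \<Phi>_def)
    also have "\<dots> \<le> u p" using below[of r y] p J by auto
    finally show ?thesis .
  qed
  define v where "v p = (if p \<in> ?B \<times> ?J then \<phi> p else u p)" for p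
  have "\<forall>x0\<in>ball 0 R. \<forall>t0\<in>time_ivl s R. \<forall>\<epsilon>>0. \<forall>\<phi>.
        ball x0 \<epsilon> \<times> {t0 - \<epsilon><..t0} \<subseteq> ball 0 R \<times> time_ivl s R \<longrightarrow>
        test_function (ball x0 \<epsilon>) {t0 - \<epsilon><..t0} \<phi> \<longrightarrow>
        u (x0, t0) = \<phi> (x0, t0) \<longrightarrow>
        (\<forall>p \<in> ball x0 \<epsilon> \<times> {t0 - \<epsilon><..t0}. \<phi> p \<le> u p) \<longrightarrow>
        (let v = (\<lambda>p. if p \<in> ball x0 \<epsilon> \<times> {t0 - \<epsilon><..t0} then \<phi> p else u p)
         in left_deriv (\<lambda>t. v (x0, t)) t0 - M_minus s lam Lam \<rho> (\<lambda>x. v (x, t0)) x0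
              \<ge> - (R powr (- 2 * s)) * a)"
    using super unfolding viscosity_super_def by blast
  moreover have "x0 \<in> ball 0 R" "?B \<times> ?J \<subseteq> ball 0 R \<times> time_ivl s R" using x0 B J by (simp, blast)
  ultimately have ineq: "- (R powr (- 2 * s)) * a \<le> left_deriv (\<lambda>t. v (x0, t)) t0
      - M_minus s lam Lam \<rho> (\<lambda>x. v (x, t0)) x0"
    using t0I \<epsilon>(1) test \<phi>0 \<phi>_le unfolding Let_def v_def[abs_def] by (metis (no_types, lifting))
  have ld: "left_deriv (\<lambda>t. v (x0, t)) t0 = bump R x0 * k' t0 - (a + \<delta>) / T"
  proof (rule left_deriv_unique)
    have "eventually (\<lambda>t. \<phi> (x0, t) = v (x0, t)) (at_left t0)"
      unfolding eventually_at_left_field using \<epsilon>(1) by (intro exI[of _ "t0 - \<epsilon>"]) (auto simp: v_def)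
    moreover have "\<phi> (x0, t0) = v (x0, t0)" using \<epsilon>(1) by (simp add: v_def)
    ultimately show "((\<lambda>t. v (x0, t)) has_real_derivative bump R x0 * k' t0 - (a + \<delta>) / T) (at_left t0)"
      using has_field_derivative_cong_eventually[of "\<lambda>t. \<phi> (x0, t)" "\<lambda>t. v (x0, t)" t0 "{..<t0}"] \<phi>_deriv[of x0 t0]
      by simp
  qed
  let ?w = "\<lambda>x. v (x, t0)" and ?U = "\<lambda>x. u (x, t0)"
  let ?I = "LINT x|lebesgue. weight s R x * ?U x" and ?J' = "LINT x|lebesgue. weight s R x * indicator ?B x"
  have Um: "?U \<in> borel_measurable borel"
    using super t0I unfolding viscosity_super_def by (intro Linf_slice_measurable) auto
  have v_eq: "?w = (\<lambda>x. if x \<in> ?B then bump R x * \<Theta> t0 - c t0 else u (x, t0))"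
    using \<epsilon>(1) k0 by (auto simp: v_def \<phi>_def fun_eq_iff)
  have v_pt: "v (y, t0) = (if y \<in> ?B then bump R y * \<Theta> t0 - c t0 else u (y, t0))" for y
    by (rule fun_cong[OF v_eq])
  have "touching s lam Lam \<rho> R (\<Theta> t0) (c t0) \<epsilon> M x0 K ?w ?U" if K: "K \<in> kernels s lam Lam \<rho>" for K
  proof
    show "?w \<in> borel_measurable borel" unfolding v_eq
      by (intro measurable_If_set Um borel_measurable_diff borel_measurable_times) auto
    show "\<Theta> t0 * bump R y - c t0 \<le> ?w y" for y
      using below[OF t0I, of y]
        by (cases "y \<in> ?B") (simp_all add: v_pt c_def \<Phi>_def mult.commute[of "\<Theta> t0"] del: mem_ball)
    show "0 \<le> c t0" using a \<delta> T t0 m by (simp add: c_def)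
    show "\<epsilon> \<le> R" using \<epsilon>(4) norm_ge_zero[of x0] by linarith
  qed (use s lam Lam \<rho> K x0 \<epsilon>(1) \<Theta>nn Um u0[OF t0I] uM[OF t0I] in \<open>simp_all add: v_pt mult.commute[of "\<Theta> t0"] del: mem_ball\<close>)
  from touch[OF this, unfolded rT]
  have "\<mu> * (?I - M * ?J') - C * bump R x0 * \<Theta> t0 / T \<le> L_op s K ?w x0"
    if "K \<in> kernels s lam Lam \<rho>" for K
    using that by (simp add: \<mu>_def)
  then have Mm: "\<mu> * (?I - M * ?J') - C * bump R x0 * \<Theta> t0 / T \<le> M_minus s lam Lam \<rho> ?w x0"
    unfolding M_minus_def using ne by (intro cINF_greatest)
  have gt: "0 \<le> g t0" "g t0 \<le> ?I" using g[OF t0I] by auto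
  have "exp (- C * (t0 + T) / T) \<le> 1" using C T t0 by (simp add: divide_nonpos_pos mult_nonpos_nonneg)
  then have "bump R x0 * exp (- C * (t0 + T) / T) \<le> 1" using bump_le_1[of R x0] bump_nonneg[of R x0]
    by (intro mult_le_one) auto
  then have 1: "bump R x0 * exp (- C * (t0 + T) / T) * (\<mu> * g t0) \<le> 1 * (\<mu> * ?I)"
    using \<mu> gt by (intro mult_mono) auto
  have 2: "\<mu> * M * ?J' < \<delta> / T"
  proof -
    have "\<mu> * M * ?J' \<le> (\<mu> * M + 1) * ?J'" 
      by (intro mult_right_mono Bochner_Integration.integral_nonneg) (auto simp: weight_nonneg)
    also have "\<dots> \<le> (\<mu> * M + 1) * (\<delta> / (2 * T * (\<mu> * M + 1)))"
      using \<epsilon>2(2)[OF \<epsilon>(1,3)] \<mu> M by (intro mult_left_mono) auto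
    also have "\<dots> = \<delta> / (2 * T)" 
    proof -
      have "z * (\<delta> / (2 * T * z)) = \<delta> / (2 * T)" if "0 < z" for z using that by simp
      moreover have "0 < \<mu> * M + 1" using \<mu> M by (intro add_nonneg_pos mult_nonneg_nonneg) auto
      ultimately show ?thesis .
    qed
    also have "\<dots> < \<delta> / T" using \<delta> T by (simp add: field_simps)
    finally show ?thesis .
  qed
  have 3: "- (a / T) \<le> bump R x0 * k' t0 - (a + \<delta>) / T - M_minus s lam Lam \<rho> ?w x0"
    using ineq unfolding ld rT by simp
  have 4: "bump R x0 * k' t0 = bump R x0 * exp (- C * (t0 + T) / T) * (\<mu> * g t0)
      - C * bump R x0 * \<Theta> t0 / T"
    by (simp add: k'_def k0 algebra_simps)
  have 5: "\<mu> * (?I - M * ?J') = \<mu> * ?I - \<mu> * M * ?J'" by (simp add: algebra_simps)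
  have 6: "(a + \<delta>) / T = a / T + \<delta> / T" by (simp add: add_divide_distrib)
  show False using 1 2 3 Mm unfolding 4 5 6 by linarith
qed


section \<open>The weak Harnack inequality\<close>

theorem theorem2p2:
  fixes s lam Lam :: real
  assumes "0 < s" "s < 1" and "0 < lam" "0 < Lam"
  shows "\<exists>c>0. \<forall>\<rho> a R. \<forall>u :: 'a::euclidean_space \<times> real \<Rightarrow> real.
           0 \<le> \<rho> \<longrightarrow> 0 \<le> a \<longrightarrow> \<rho> < R \<longrightarrow>
           (kernels s lam Lam \<rho> :: ('a \<Rightarrow> real) set) \<noteq> {} \<longrightarrow>
           u \<in> Linf (UNIV \<times> time_ivl s R) \<longrightarrow>
           (\<forall>x. \<forall>t\<in>closed_time_ivl s R. 0 \<le> u (x, t)) \<longrightarrow>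
           viscosity_super s lam Lam \<rho> (ball 0 R) (time_ivl s R)
             (\<lambda>_. - (R powr (- 2 * s)) * a) u \<longrightarrow>
           (INF p \<in> cylinder s (R / 2). u p)
             \<ge> c * (LINT t:time_ivl s R - time_ivl s (R / 2)|lebesgue.
                      (LINT x|lebesgue. u (x, t) / (R + norm x) powr (real DIM('a) + 2 * s)))
               - a"
proof -
  note s = assms(1,2) and lam = assms(3) and Lam = assms(4)
  obtain C where C: "0 \<le> C" and touch:
    "\<And>\<rho> R \<theta> q \<epsilon> M (x0::'a) K v U. touching s lam Lam \<rho> R \<theta> q \<epsilon> M x0 K v U \<Longrightarrow>
      lam / 4 * ((LINT x|lebesgue. weight s R x * U x) - M * (LINT x|lebesgue. weight s R x * indicator (ball x0 \<epsilon>) x))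
        - C * bump R x0 * \<theta> * R powr (- 2 * s) \<le> L_op s K v x0"
    using L_op_touching_lower_bound[OF s lam Lam, where 'a = 'a] by blast
  define n where "n = real DIM('a) + 2 * s"
  define \<kappa> where "\<kappa> = 9 / 16 * (exp (- C) * (lam / 4))"
  have \<kappa>: "0 < \<kappa>" using lam by (simp add: \<kappa>_def)
  have main: "\<kappa> * 2 powr (- n) * (LINT t:time_ivl s R - time_ivl s (R / 2)|lebesgue.
                      (LINT x|lebesgue. u (x, t) / (R + norm x) powr n)) - a \<le> (INF p \<in> cylinder s (R / 2). u p)"
    if \<rho>: "0 \<le> \<rho>" "\<rho> < R" and a: "0 \<le> a"
      and ne: "(kernels s lam Lam \<rho> :: ('a \<Rightarrow> real) set) \<noteq> {}"
      and uL: "u \<in> Linf (UNIV \<times> time_ivl s R)"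
      and u0': "\<And>x t. t \<in> closed_time_ivl s R \<Longrightarrow> 0 \<le> u (x, t)"
      and super: "viscosity_super s lam Lam \<rho> (ball 0 R) (time_ivl s R) (\<lambda>_. - (R powr (- 2 * s)) * a) u"
    for \<rho> a R and u :: "'a \<times> real \<Rightarrow> real"
  proof -
    have R: "0 < R" using \<rho> by simp
    define T where "T = R powr (2 * s)"
    define T' where "T' = (R / 2) powr (2 * s)"
    have T: "0 < T" "T' < T" "0 < T'" using R s by (auto simp: T_def T'_def powr_less_mono2)
    have I: "time_ivl s R = {- T<..0}" "time_ivl s (R / 2) = {- T'<..0}"
      by (simp_all add: time_ivl_def T_def T'_def)
    have A: "time_ivl s R - time_ivl s (R / 2) = {- T<..- T'}" using T by (auto simp: I)
    have u0: "0 \<le> u (x, t)" if "t \<in> time_ivl s R" for x t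
      using u0'[of t x] that by (simp add: time_ivl_def closed_time_ivl_def)
    obtain M where bound: "\<And>p. p \<in> UNIV \<times> time_ivl s R \<Longrightarrow> norm (u p) \<le> M"
      using uL by (auto simp: Linf_def bounded_iff)
    have uM: "u (x, t) \<le> M" if "t \<in> time_ivl s R" for x t
      using bound[of "(x, t)"] that by auto
    have M: "0 \<le> M" using u0[of 0 0] uM[of 0 0] T by (simp add: I)
    have w: "integrable lebesgue (weight s R :: 'a \<Rightarrow> real)"
      using weight_integral_bound[OF s lam Lam, where 'a = 'a] \<rho> ne by blast
    define gw where "gw t = (LINT x|lebesgue. weight s R x * u (x, t))" for t
    define W where "W = (LINT x|lebesgue. weight s R (x::'a))"
    have W: "0 \<le> W" unfolding W_def by (intro Bochner_Integration.integral_nonneg weight_nonneg)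
    have gw: "0 \<le> gw t \<and> gw t \<le> M * W" if t: "t \<in> time_ivl s R" for t
    proof
      show "0 \<le> gw t" unfolding gw_def
        by (intro Bochner_Integration.integral_nonneg mult_nonneg_nonneg weight_nonneg u0 t)
      have "gw t \<le> (LINT x|lebesgue. M * weight s R (x::'a))" unfolding gw_def
      proof (intro integral_mono)
        show "integrable lebesgue (\<lambda>x. weight s R x * u (x, t))"
          by (rule integrable_weight_times_bounded[OF w Linf_slice_measurable[OF uL t], where B = M])
             (use u0[OF t] uM[OF t] in auto)
        show "integrable lebesgue (\<lambda>x. M * weight s R (x::'a))" by (intro integrable_mult_right w)
        show "weight s R x * u (x, t) \<le> M * weight s R x" for x
          using mult_left_mono[OF uM[OF t, of x] weight_nonneg[of s R x]] by (simp add: mult.commute)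
      qed
      then show "gw t \<le> M * W" by (simp add: W_def)
    qed
    have inner: "(LINT x|lebesgue. u (x, t) / (R + norm x) powr n) = 2 powr n * gw t" for t
    proof -
      have "u (x, t) / (R + norm x) powr n = 2 powr n * (weight s R x * u (x, t))" for x
      proof -
        have "weight s R x = 2 powr (- n) * (R + norm x) powr (- n)"
          unfolding weight_def n_def by (rule powr_mult)
        then have "weight s R x = 1 / 2 powr n * (1 / (R + norm x) powr n)"
          by (simp add: powr_minus_divide)
        then show ?thesis by simp
      qed
      then show ?thesis by (simp add: gw_def)
    qed
    define g where "g t = indicator {- T<..- T'} t * gw t" for t
    have sub: "{- T<..- T'} \<subseteq> time_ivl s R" using T by (auto simp: I)
    have outer: "(LINT t:time_ivl s R - time_ivl s (R / 2)|lebesgue. (LINT x|lebesgue. u (x, t) / (R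
        + norm x) powr n))
        = 2 powr n * (LINT t|lebesgue. g t)"
      unfolding A inner set_lebesgue_integral_def g_def by (simp add: mult.left_commute)
    have goal_eq: "\<kappa> * 2 powr (- n) * (LINT t:time_ivl s R - time_ivl s (R / 2)|lebesgue.
                      (LINT x|lebesgue. u (x, t) / (R + norm x) powr n)) = \<kappa> * (LINT t|lebesgue. g t)"
      unfolding outer by (simp add: powr_minus)
    have pointwise: "\<kappa> * (LINT t|lebesgue. g t) - a \<le> u p" if p: "p \<in> cylinder s (R / 2)" for p
    proof (cases "integrable lebesgue g")
      \<comment> \<open>If \<open>g\<close> is not integrable, its Bochner integral is zero by default and \<open>u \<ge> 0\<close> suffices.\<close>
      case False
      obtain x t where xt: "p = (x, t)" "t \<in> time_ivl s R"
        using p T by (cases p) (auto simp: cylinder_def I)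
      then show ?thesis using u0[OF xt(2), of x] a not_integrable_integral_eq[OF False] by simp
    next
      case True
      obtain x t where xt: "p = (x, t)" "norm x < R / 2" "- T' < t" "t \<le> 0"
        using p by (cases p) (auto simp: cylinder_def I)
      then have x: "x \<in> ball 0 R" and t: "t \<in> time_ivl s R" using T R by (auto simp: I)
      have g_bd: "0 \<le> g t \<and> g t \<le> M * W + 1" for t
      proof (cases "t \<in> {- T<..- T'}")
        case True
        then have "t \<in> time_ivl s R" using sub by blast
        from gw[OF this] show ?thesis using True by (simp add: g_def)
      next
        case False
        then show ?thesis using M W by (simp add: g_def)
      qed
      have g_le: "0 \<le> g t \<and> g t \<le> (LINT x|lebesgue. weight s R x * u (x, t))" if "t \<in> time_ivl s R" for t
        using gw[OF that] by (auto simp: g_def indicator_def gw_def[symmetric])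
      show ?thesis
      proof (rule field_le_epsilon)
        fix e :: real assume e: "0 < e"
        \<comment> \<open>One \<open>\<eta>\<close> is lost in \<open>H\<close>, with factor \<open>\<kappa>\<close>, and two more are lost to the strictness of
          the barrier.\<close>
        define \<eta> where "\<eta> = e / (\<kappa> + 2)"
        have \<eta>: "0 < \<eta>" using e \<kappa> by (simp add: \<eta>_def)
        have ab: "- T \<le> - T'" and G: "0 < M * W + 1" using T M W by (auto simp: add_nonneg_pos)
        obtain H where H: "mono H" "\<And>t. t \<le> - T \<Longrightarrow> H t = 0"
            "\<And>t. - T' \<le> t \<Longrightarrow> (LINT t|lebesgue. g t) - \<eta> \<le> H t"
            "\<And>t t'. t \<le> t' \<Longrightarrow> H t' - H t \<le> (M * W + 1) * (t' - t)"
            "\<And>t0. \<exists>\<epsilon>>0. \<forall>t\<in>{t0 - \<epsilon><..t0}. H t0 - H t \<le> g t0 * (t0 - t)"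
        proof (rule ex_minor_function[OF ab True g_bd _ \<eta> G])
          show "g t = 0" if "t \<notin> {- T<..- T'}" for t using that by (simp add: g_def)
        qed blast
        have "bump R x * (exp (- C * (t + T) / T) * (lam / 4 * H t)) - (a + \<eta>) * (t + T) / T - \<eta>
            \<le> u (x, t)"
          by (rule supersolution_above_barrier[where \<rho> = \<rho> and R = R and s = s and Lam = Lam and M = M and H = H and g = g
                and L = "M * W + 1", folded T_def])
             (rule s lam Lam \<rho> a \<eta> C ne w super H(1) x t H(5) | erule touch u0 uM H(2) H(4) g_le)+
        moreover have "\<kappa> * H t \<le> bump R x * (exp (- C * (t + T) / T) * (lam / 4 * H t))"
        proof -
          have Hnn: "0 \<le> H t" using H(2)[of "- T"] monoD[OF H(1), of "- T" t] t by (simp add: I)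
          have "(t + T) / T \<le> 1" using xt T by simp
          then have "C * ((t + T) / T) \<le> C * 1" using C by (intro mult_left_mono) auto
          then have "exp (- C) \<le> exp (- C * (t + T) / T)" by simp
          then have "9 / 16 * (exp (- C) * (lam / 4 * H t))
              \<le> bump R x * (exp (- C * (t + T) / T) * (lam / 4 * H t))"
            using bump_ge_half_ball[of x R] xt R Hnn lam
            by (intro mult_mono mult_right_mono) auto
          then show ?thesis by (simp add: \<kappa>_def mult_ac)
        qed
        moreover have "\<kappa> * ((LINT t|lebesgue. g t) - \<eta>) \<le> \<kappa> * H t"
          using H(3)[of t] xt \<kappa> by (intro mult_left_mono) auto
        moreover have "(a + \<eta>) * (t + T) / T \<le> a + \<eta>"
          using mult_left_mono[of "(t + T) / T" 1 "a + \<eta>"] xt T a \<eta> by simp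
        moreover have "\<kappa> * ((LINT t|lebesgue. g t) - \<eta>) = \<kappa> * (LINT t|lebesgue. g t) - \<kappa> * \<eta>"
          by (simp add: algebra_simps)
        moreover have "e = \<kappa> * \<eta> + 2 * \<eta>"
        proof -
          have "e = (\<kappa> + 2) * \<eta>" using \<kappa> by (simp add: \<eta>_def)
          then show ?thesis by (simp add: distrib_right)
        qed
        ultimately show "\<kappa> * (LINT t|lebesgue. g t) - a \<le> u p + e" unfolding xt(1) by linarith
      qed
    qed
    have "(0, 0) \<in> cylinder s (R / 2)" using R T by (simp add: cylinder_def I)
    then show ?thesis unfolding goal_eq by (intro cINF_greatest pointwise) auto
  qed
  show ?thesis
    using main \<kappa> unfolding n_def by (intro exI[of _ "\<kappa> * 2 powr (- (real DIM('a) + 2 * s))"]) auto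
qed

end
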